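(* Let $N\ge 1$ be an integer, let $\vec X = (X_1,\dots,X_N)$ be a vector chosen uniformly at random from the unit Euclidean sphere $S^{N-1}\subset\mathbb R^N$, and let $\Phi$ be the standard Gaussian CDF. Let $\gamma$, $g_+$, $g_-$ be the functions on $[0,1)$ defined in the context. Then for all $\epsilon>0$ and all $t\in[0,1)$, $$\Pr\left(d_{\mathrm{KS}}\left(\widehat F_{\sqrt N\vec X},\Phi\right) > \epsilon+\gamma(t)\right)\le 2e^{-2N\epsilon^2}+e^{-N g_+(t)^2}+e^{-N g_-(t)^2}.$$
   Context: The empirical CDF of a random vector $\vec V=(V_1,\dots,V_N)$ with real-valued (not necessarily independent) components is $\widehat F_{\vec V}(x)=\frac1N\sum_{i=1}^N \mathbf 1_{\{V_i\le x\}}$, $x\in\mathbb R$. The Kolmogorov-Smirnov distance between CDFs $F$ and $G$ is $d_{\mathrm{KS}}(F,G)=\sup_{x\in\mathbb R}|F(x)-G(x)|$. Here $\sqrt N\vec X=(\sqrt N X_1,\dots,\sqrt N X_N)$. For $t\in[0,1)$ define $$\Phi_t^{+}(x)=\Phi\left(\frac{x}{1-\operatorname{sgn}(x)\,t}\right),\qquad \gamma(t)=\sup_{x\in\mathbb R}\left(\Phi_t^+(x)-\Phi(x)\right),$$ where $\operatorname{sgn}$ is the sign function, and $$g_+(t)=\frac12\left(1-\frac{1}{(1+t)^2}\right),\qquad g_-(t)=\frac12\left(\sqrt{\frac{2}{(1-t)^2}-1}-1\right).$$ *)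

theory Defs
  imports "HOL-Probability.Probability"
begin

text \<open>
  Normalized surface measure on the unit sphere, via polar coordinates: the surface area of a set
  \<open>A\<close> of unit vectors is proportional to the Lebesgue measure of the solid cone
  \<open>{r u | 0 < r < 1, u \<in> A}\<close> over \<open>A\<close>, i.e. the uniform law on the sphere is the law of
  \<open>x / |x|\<close> for \<open>x\<close> uniform in the unit ball. It is carried by the sphere and invariant under
  orthogonal transformations (proved below; the well-ordered index type in the invariance lemma is
  inherited from the change of variables results of the library). In dimension one it is the uniform distribution
  on \<open>{-1, 1}\<close>.
\<close>

definition uniform_sphere :: "'a::euclidean_space measure" where
  "uniform_sphere = distr (uniform_measure lborel (ball 0 1)) borel (\<lambda>x. x /\<^sub>R norm x)"

text \<open>Empirical CDF of (a realization of) a random vector.\<close>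

definition ecdf :: "real ^ 'n \<Rightarrow> real \<Rightarrow> real" where
  "ecdf V x = 1 / real CARD('n) * (\<Sum>i\<in>UNIV. of_bool (V $ i \<le> x))"

definition ks_dist :: "(real \<Rightarrow> real) \<Rightarrow> (real \<Rightarrow> real) \<Rightarrow> real" where
  "ks_dist F G = (SUP x. \<bar>F x - G x\<bar>)"

definition std_normal_cdf :: "real \<Rightarrow> real" where
  "std_normal_cdf = cdf std_normal_distribution"

definition Phi_plus :: "real \<Rightarrow> real \<Rightarrow> real" where
  "Phi_plus t x = std_normal_cdf (x / (1 - sgn x * t))"

definition gamma_dev :: "real \<Rightarrow> real" where
  "gamma_dev t = (SUP x. Phi_plus t x - std_normal_cdf x)"

definition g_plus :: "real \<Rightarrow> real" where
  "g_plus t = 1 / 2 * (1 - 1 / (1 + t)\<^sup>2)"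

definition g_minus :: "real \<Rightarrow> real" where
  "g_minus t = 1 / 2 * (sqrt (2 / (1 - t)\<^sup>2 - 1) - 1)"

lemma emeasure_unit_ball:
  "0 < emeasure lborel (ball (0::'a::euclidean_space) 1)"
  "emeasure lborel (ball (0::'a::euclidean_space) 1) < \<infinity>"
  by (auto simp: emeasure_ball unit_ball_vol_pos)

lemma sphere_projection_measurable [measurable]:
  "(\<lambda>x::'a::euclidean_space. x /\<^sub>R norm x) \<in> borel_measurable borel"
  by measurable

lemma prob_space_uniform_sphere: "prob_space (uniform_sphere :: 'a::euclidean_space measure)"
proof -
  interpret prob_space "uniform_measure lborel (ball (0::'a) 1)"
    using emeasure_unit_ball[where 'a='a] by (intro prob_space_uniform_measure) auto
  show ?thesis
    unfolding uniform_sphere_def by (intro prob_space_distr) simp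
qed

lemma AE_uniform_sphere: "AE x in (uniform_sphere :: 'a::euclidean_space measure). x \<in> sphere 0 1"
proof -
  have "AE x in lborel. x \<noteq> (0::'a)"
    by (rule AE_lborel_singleton)
  then have "AE x in lborel. x \<in> ball 0 1 \<longrightarrow> x /\<^sub>R norm x \<in> sphere (0::'a) 1"
    by eventually_elim auto
  then have "AE x in uniform_measure lborel (ball 0 1). x /\<^sub>R norm x \<in> sphere (0::'a) 1"
    using emeasure_unit_ball[where 'a='a] by (intro AE_uniform_measureI) auto
  then show ?thesis
    unfolding uniform_sphere_def by (subst AE_distr_iff) auto
qed

lemma emeasure_lborel_orthogonal_vimage:
  fixes f :: "real ^ 'n::{finite,wellorder} \<Rightarrow> real ^ 'n::_"
  assumes f: "orthogonal_transformation f" and A: "A \<in> sets borel" and fin: "emeasure lborel A < \<infinity>"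
  shows "emeasure lborel (f -` A) = emeasure lborel A"
proof -
  have g: "orthogonal_transformation (inv f)"
    using f by (rule orthogonal_transformation_inv)
  have im: "f -` A = inv f ` A"
    using f by (simp add: bij_vimage_eq_inv_image orthogonal_transformation_bij)
  have fm: "f \<in> borel_measurable borel"
    using f by (intro borel_measurable_continuous_onI linear_continuous_on)
      (simp add: linear_conv_bounded_linear[symmetric] orthogonal_transformation_linear)
  have B: "f -` A \<in> sets borel"
    using measurable_sets[OF fm A] by simp
  have L: "A \<in> lmeasurable"
    using A fin by (intro fmeasurableI) auto
  have "inv f ` A \<in> lmeasurable" "measure lebesgue (inv f ` A) = measure lebesgue A"
    using measurable_orthogonal_image[OF g L] measure_orthogonal_image[OF g L] by auto
  then have "emeasure lebesgue (f -` A) = emeasure lebesgue A"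
    using L by (simp add: im emeasure_eq_measure2)
  then show ?thesis
    using A B by simp
qed

lemma uniform_sphere_orthogonal_invariant:
  fixes f :: "real ^ 'n::{finite,wellorder} \<Rightarrow> real ^ 'n::_"
  assumes f: "orthogonal_transformation f"
  shows "distr uniform_sphere borel f = uniform_sphere"
proof (rule measure_eqI)
  fix A assume "A \<in> sets (distr uniform_sphere borel f)"
  then have A [measurable]: "A \<in> sets borel" by simp
  have [measurable]: "f \<in> borel_measurable borel"
    using f by (intro borel_measurable_continuous_onI linear_continuous_on)
      (simp add: linear_conv_bounded_linear[symmetric] orthogonal_transformation_linear)
  let ?p = "\<lambda>x::real^'n::_. x /\<^sub>R norm x" and ?B = "ball 0 1 :: (real ^ 'n::_) set"
  have pB: "?p -` C \<in> sets borel" if "C \<in> sets borel" for C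
    using measurable_sets[OF sphere_projection_measurable that] by simp
  have fA: "f -` A \<in> sets borel"
    using measurable_sets[of f borel borel A] by simp
  have *: "?B \<inter> ?p -` (f -` A) = f -` (?B \<inter> ?p -` A)"
    using f by (auto simp: orthogonal_transformation linear_scale)
  have "emeasure lborel (?B \<inter> ?p -` A) \<le> emeasure lborel ?B"
    by (intro emeasure_mono) auto
  then have "emeasure lborel (?B \<inter> ?p -` A) < \<infinity>"
    using emeasure_unit_ball(2) by (rule le_less_trans)
  then have "emeasure lborel (?B \<inter> ?p -` (f -` A)) = emeasure lborel (?B \<inter> ?p -` A)"
    unfolding * using pB[OF A] by (intro emeasure_lborel_orthogonal_vimage f) auto
  then show "emeasure (distr uniform_sphere borel f) A = emeasure uniform_sphere A"
    using pB[OF A] pB[OF fA] fA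
    by (simp add: uniform_sphere_def emeasure_distr)
qed (simp add: uniform_sphere_def)

text \<open>The suprema below are taken over bounded sets, and the deviation events are measurable.\<close>

lemma std_normal_cdf_bounds: "0 \<le> std_normal_cdf x" "std_normal_cdf x \<le> 1"
proof -
  interpret prob_space std_normal_distribution
    by (rule prob_space_normal_density) simp
  show "0 \<le> std_normal_cdf x" "std_normal_cdf x \<le> 1"
    by (simp_all add: std_normal_cdf_def cdf_def)
qed

lemma ecdf_bounds: "0 \<le> ecdf V x" "ecdf V x \<le> 1"
proof -
  show "0 \<le> ecdf V x" by (simp add: ecdf_def sum_nonneg)
  have "(\<Sum>i\<in>UNIV. of_bool (V $ i \<le> x) :: real) \<le> (\<Sum>i\<in>(UNIV :: 'a set). 1)"
    by (intro sum_mono) auto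
  then show "ecdf V x \<le> 1" by (simp add: ecdf_def)
qed

lemma bdd_above_gamma_dev: "bdd_above (range (\<lambda>x. Phi_plus t x - std_normal_cdf x))"
proof (rule bdd_aboveI2)
  show "Phi_plus t x - std_normal_cdf x \<le> 1" for x
    using std_normal_cdf_bounds(1)[of x] std_normal_cdf_bounds(2)[of "x / (1 - sgn x * t)"]
    by (simp add: Phi_plus_def)
qed

lemma bdd_above_ks_dist: "bdd_above (range (\<lambda>x. \<bar>ecdf V x - std_normal_cdf x\<bar>))"
proof (rule bdd_aboveI2)
  show "\<bar>ecdf V x - std_normal_cdf x\<bar> \<le> 1" for x
    using std_normal_cdf_bounds[of x] ecdf_bounds[of V x] by linarith
qed

lemma ecdf_right_cont: "(ecdf V \<longlongrightarrow> ecdf V x) (at_right x)"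
proof -
  have "((\<lambda>y. of_bool (V $ i \<le> y) :: real) \<longlongrightarrow> of_bool (V $ i \<le> x)) (at_right x)" for i
  proof (rule tendsto_eventually)
    show "\<forall>\<^sub>F y in at_right x. (of_bool (V $ i \<le> y) :: real) = of_bool (V $ i \<le> x)"
    proof (cases "V $ i \<le> x")
      case True
      then show ?thesis
        by (auto simp: eventually_at_right_field intro!: exI[of _ "x + 1"])
    next
      case False
      then show ?thesis
        by (auto simp: eventually_at_right_field intro!: exI[of _ "V $ i"])
    qed
  qed
  then show ?thesis
    unfolding ecdf_def by (intro tendsto_intros)
qed

lemma std_normal_cdf_right_cont: "(std_normal_cdf \<longlongrightarrow> std_normal_cdf x) (at_right x)"
proof -
  interpret real_distribution std_normal_distribution
    by (rule real_dist_normal_dist)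
  show ?thesis
    using cdf_is_right_cont[of x] by (simp add: std_normal_cdf_def continuous_within)
qed

lemma ks_dist_measurable [measurable]:
  "(\<lambda>V::real^'n. ks_dist (ecdf V) std_normal_cdf) \<in> borel_measurable borel"
proof (rule borel_measurableI_greater)
  fix c
  let ?D = "\<lambda>V::real^'n. \<lambda>x. \<bar>ecdf V x - std_normal_cdf x\<bar>"
  have "(\<exists>x. c < ?D V x) \<longleftrightarrow> (\<exists>x\<in>\<rat>. c < ?D V x)" for V
  proof
    assume "\<exists>x. c < ?D V x"
    then obtain x where x: "c < ?D V x" ..
    have "(?D V \<longlongrightarrow> ?D V x) (at_right x)"
      by (intro tendsto_intros ecdf_right_cont std_normal_cdf_right_cont)
    then have "\<forall>\<^sub>F y in at_right x. c < ?D V y"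
      using x by (rule order_tendstoD)
    then obtain b where b: "x < b" "\<And>y. x < y \<Longrightarrow> y < b \<Longrightarrow> c < ?D V y"
      by (auto simp: eventually_at_right_field)
    obtain q where "q \<in> \<rat>" "x < q" "q < b"
      using Rats_dense_in_real[OF b(1)] by blast
    with b(2) show "\<exists>x\<in>\<rat>. c < ?D V x" by blast
  qed blast
  then have "{V \<in> space (borel :: (real ^ 'n) measure). c < ks_dist (ecdf V) std_normal_cdf} =
      (\<Union>x\<in>\<rat>. {V \<in> space (borel :: (real ^ 'n) measure). c < ?D V x})"
    unfolding ks_dist_def by (auto simp: less_cSUP_iff[OF _ bdd_above_ks_dist])
  also have "\<dots> \<in> sets borel"
  proof (rule sets.countable_UN'')
    show "countable (\<rat> :: real set)" by (rule countable_rat)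
    fix x :: real
    have [measurable]: "(\<lambda>V::real^'n. V $ i) \<in> borel_measurable borel" for i
      by (intro borel_measurable_continuous_onI continuous_intros)
    show "{V \<in> space (borel :: (real ^ 'n) measure). c < ?D V x} \<in> sets borel"
      unfolding ecdf_def by measurable
  qed
  finally show "{V \<in> space (borel :: (real ^ 'n) measure). c < ks_dist (ecdf V) std_normal_cdf} \<in> sets borel"
    by simp
qed

end

theory Submission
  imports Defs
begin

text \<open>
  A standard Gaussian vector \<open>Z\<close> has uniform direction, so \<open>X\<close> may be taken to be \<open>Z / |Z|\<close>, and the
  empirical CDF of \<open>sqrt N X\<close> at \<open>x\<close> is that of \<open>Z\<close> at \<open>r x\<close>, where \<open>r = |Z| / sqrt N\<close>. Chernoff bounds for
  the chi-square law of \<open>|Z|\<^sup>2\<close> confine \<open>r\<close> to \<open>[1 / (1 + t), 1 / (1 - t)]\<close>, where \<open>gamma_dev t\<close>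
  bounds the change from \<open>r x\<close> to \<open>x\<close>; the empirical CDF of \<open>Z\<close> is controlled by the
  Dvoretzky-Kiefer-Wolfowitz inequality with Massart's constant.

  The latter reduces to \<open>n\<close> uniform points on \<open>[0, n]\<close>, whose counting function should stay below
  \<open>z + b\<close>, where \<open>b = n \<epsilon>\<close>. Scan \<open>[0, n]\<close> from the right: when \<open>j\<close> points remain in \<open>[0, y]\<close>, they are
  uniform there, and the crossing probability is at most any nonnegative function \<open>h\<close> of \<open>(j, y)\<close>
  which is at least \<open>1\<close> on the barrier \<open>j = y + b\<close> and satisfies
  \<open>j h(j - 1, y) \<le> y \<partial>h/\<partial>y + j h(j, y)\<close>. With \<open>d = b + y - j\<close> and \<open>a + a\<^sup>2 / 6 = 2 b / y\<close>, the
  function \<open>h = exp (- d a - d\<^sup>2 a\<^sup>2 / (6 b))\<close> qualifies, and at \<open>j = y = n\<close> it equals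
  \<open>exp (- 2 b\<^sup>2 / n) = exp (- 2 n \<epsilon>\<^sup>2)\<close>.
\<close>

section \<open>The supersolution\<close>

text \<open>Up to the factor \<open>12 + 6 * w + w\<^sup>2\<close>, this bounds
  \<open>exp (- w)\<close> by its diagonal Pade approximant of order two. The difference
  \<open>g\<close> and its first derivative vanish at 0, and the second derivative is nonnegative by
  the quadratic Taylor bound for \<open>exp\<close>.\<close>

lemma one_minus_exp_minus_ge_pade:
  fixes w :: real
  assumes "0 \<le> w"
  shows "12 * w \<le> (12 + 6 * w + w\<^sup>2) * (1 - exp (- w))"
proof -
  define g where "g = (\<lambda>w::real. 12 - 6 * w + w\<^sup>2 - (12 + 6 * w + w\<^sup>2) * exp (- w))"
  define g' where "g' = (\<lambda>w::real. -6 + 2 * w + (6 + 4 * w + w\<^sup>2) * exp (- w))"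
  have d2: "(g' has_real_derivative (2 - (2 + 2 * x + x\<^sup>2) * exp (- x))) (at x)" for x
    unfolding g'_def by (auto intro!: derivative_eq_intros simp: algebra_simps)
  have d1: "(g has_real_derivative g' x) (at x)" for x
    unfolding g_def g'_def by (auto intro!: derivative_eq_intros simp: algebra_simps)
  have g'': "0 \<le> 2 - (2 + 2 * x + x\<^sup>2) * exp (- x)" if "0 \<le> x" for x :: real
  proof -
    have "1 + x + x\<^sup>2 / 2 \<le> exp x"
      using that by (rule exp_lower_Taylor_quadratic)
    then show ?thesis
      by (simp add: exp_minus field_simps)
  qed
  have g': "0 \<le> g' x" if "0 \<le> x" for x
  proof -
    have "g' 0 \<le> g' x"
      by (rule DERIV_nonneg_imp_nondecreasing[OF that]) (use d2 g'' in blast)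
    then show ?thesis by (simp add: g'_def)
  qed
  have "g 0 \<le> g w"
    by (rule DERIV_nonneg_imp_nondecreasing[OF assms]) (use d1 g' in blast)
  then show ?thesis by (simp add: g_def algebra_simps)
qed

text \<open>This is the differential inequality for \<open>envelope\<close> in the scale-free
  variables \<open>a = slope b y\<close> and \<open>e = (b + y - j) / b\<close>, divided by
  \<open>b * envelope b j y\<close>, with the jump factor bounded by \<open>exp (- w)\<close>. The
  assumption \<open>j\<close> says that the number of points is nonnegative. The Pade bound makes
  everything rational, so that a polynomial in \<open>e\<close> decides the sign.\<close>

lemma supersolution_inequality:
  fixes a e w :: real
  defines "w \<equiv> a + e * a\<^sup>2 / 3"
  assumes a: "0 < a" and e: "0 \<le> e" and j: "0 \<le> 1 - e + 12 / (a * (6 + a))"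
  shows "0 \<le> w * (e * (6 + a) / (2 * (3 + a)) - 12 / (a * (6 + a)))
             + (1 - e + 12 / (a * (6 + a))) * (1 - exp (- w))"
proof -
  have w: "0 < w" using a e by (simp add: w_def add_pos_nonneg)
  define D where "D = 12 + 6 * w + w\<^sup>2"
  have D: "0 < D" using w by (simp add: D_def add_pos_pos)
  have pade: "12 * w / D \<le> 1 - exp (- w)"
    using one_minus_exp_minus_ge_pade[of w] w D
    by (simp add: D_def divide_le_eq mult.commute)
  have pos: "0 < 6 + a" "0 < 3 + a" "0 < a * (6 + a)" using a by simp_all
  define c0 where "c0 = (2 * a^3 + a^4) / (24 * (3 + a) * (6 + a))"
  define c1 where "c1 = (6 + a) * a\<^sup>2 / 36 - a^3 / (9 * (6 + a))"
  define c2 where "c2 = (6 + a) * a^4 / (216 * (3 + a))"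
  have c: "0 \<le> c0" "0 \<le> c2" using a by (simp_all add: c0_def c2_def)
  \<comment> \<open>Of the three coefficients only \<open>c1\<close> contains a subtraction; a
    common denominator reveals its sign.\<close>
  have "c1 = a\<^sup>2 * ((6 + a)\<^sup>2 - 4 * a) / (36 * (6 + a))"
    using pos unfolding c1_def by (simp add: field_simps power2_eq_square power3_eq_cube)
  also have "(6 + a)\<^sup>2 - 4 * a = 36 + 8 * a + a\<^sup>2"
    by (simp add: power2_eq_square algebra_simps)
  finally have c1: "0 \<le> c1" using a by simp
  \<comment> \<open>Once the Pade bound replaces the exponential and \<open>w * (12 / D)\<close> is
    factored out, a cubic in \<open>e\<close> with nonnegative coefficients remains. It vanishes on
    the barrier \<open>e = 0\<close>.\<close>
  have id: "(e * (6 + a) / (2 * (3 + a)) - 12 / (a * (6 + a))) * (D / 12)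
      + (1 - e + 12 / (a * (6 + a))) = e * (c0 + c1 * e + c2 * e\<^sup>2)"
    using a pos unfolding D_def w_def c0_def c1_def c2_def
    by (simp add: divide_simps)
      (simp add: algebra_simps power2_eq_square power3_eq_cube power4_eq_xxxx)
  have "0 \<le> w * (12 / D) * (e * (c0 + c1 * e + c2 * e\<^sup>2))"
    using w D e c c1 by (intro mult_nonneg_nonneg add_nonneg_nonneg) auto
  also have "\<dots> = w * (e * (6 + a) / (2 * (3 + a)) - 12 / (a * (6 + a)))
      + (1 - e + 12 / (a * (6 + a))) * (12 * w / D)"
    unfolding id[symmetric] using D by (simp add: field_simps)
  also have "\<dots> \<le> w * (e * (6 + a) / (2 * (3 + a)) - 12 / (a * (6 + a)))
      + (1 - e + 12 / (a * (6 + a))) * (1 - exp (- w))"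
    using j pade by (intro add_left_mono mult_left_mono) auto
  finally show ?thesis .
qed

text \<open>\<open>slope b y\<close> is the positive root \<open>a\<close> of \<open>a + a\<^sup>2 / 6 = 2 * b / y\<close>. Taking the Brownian slope
  \<open>2 * b / y\<close> itself, without the quadratic correction, does not give a supersolution near the
  barrier.\<close>

definition slope :: "real \<Rightarrow> real \<Rightarrow> real" where
  "slope b y = 3 * (sqrt (1 + 4 * b / (3 * y)) - 1)"

text \<open>\<open>envelope b j y\<close> bounds the probability that \<open>j\<close> uniform points on \<open>[0, y]\<close> cross the barrier
  \<open>z \<mapsto> z + b\<close>. It is \<open>1\<close> on the barrier \<open>j = b + y\<close>, and its value at \<open>j = y\<close> is the
  bound of Dvoretzky, Kiefer, Wolfowitz and Massart.\<close>

definition envelope :: "real \<Rightarrow> real \<Rightarrow> real \<Rightarrow> real" where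
  "envelope b j y = exp (- ((b + y - j) * slope b y + (b + y - j)\<^sup>2 * (slope b y)\<^sup>2 / (6 * b)))"

lemma slope_pos: "0 < b \<Longrightarrow> 0 < y \<Longrightarrow> 0 < slope b y"
  by (simp add: slope_def)

lemma slope_eq:
  assumes "0 < b" "0 < y"
  shows "slope b y * (6 + slope b y) * y = 12 * b"
proof -
  define s where "s = sqrt (1 + 4 * b / (3 * y))"
  have "s\<^sup>2 - 1 = 4 * b / (3 * y)"
    using assms unfolding s_def by (subst real_sqrt_pow2) auto
  then have "(s\<^sup>2 - 1) * y = 4 * b / 3" using assms by simp
  moreover have sl: "slope b y = 3 * (s - 1)" by (simp add: slope_def s_def)
  have "slope b y * (6 + slope b y) * y = 9 * ((s\<^sup>2 - 1) * y)"
    unfolding sl by (simp add: algebra_simps power2_eq_square)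
  ultimately show ?thesis by linarith
qed

text \<open>The formula is the one given by implicit differentiation of
  \<open>a + a\<^sup>2 / 6 = 2 * b / y\<close>. It is rational in the slope, as the algebra of the
  supersolution requires.\<close>

lemma slope_has_derivative:
  assumes "0 < b" "0 < y"
  shows "(slope b has_real_derivative
    - (slope b y * (6 + slope b y) / (2 * (3 + slope b y))) / y) (at y)"
proof -
  define s where "s = sqrt (1 + 4 * b / (3 * y))"
  have pos: "0 < 1 + 4 * b / (3 * y)" using assms by (simp add: add_pos_pos)
  have s: "1 < s" using assms unfolding s_def by simp
  have "((\<lambda>y. 1 + 4 * b / (3 * y)) has_real_derivative - (4 * b / (3 * y\<^sup>2))) (at y)"
    using assms by (auto intro!: derivative_eq_intros simp: field_simps power2_eq_square)
  from DERIV_chain2[OF DERIV_real_sqrt[OF pos] this]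
  have "(slope b has_real_derivative (3 * (inverse s / 2 * (- (4 * b / (3 * y\<^sup>2)))))) (at y)"
    unfolding slope_def[abs_def] s_def[symmetric]
    by (intro DERIV_cmult DERIV_diff[where E = 0, simplified] DERIV_const) (simp add: s_def)
  moreover have "3 * (inverse s / 2 * (- (4 * b / (3 * y\<^sup>2)))) =
      - (slope b y * (6 + slope b y) / (2 * (3 + slope b y))) / y"
  proof -
    have "slope b y * (6 + slope b y) = 12 * b / y"
      using slope_eq[OF assms] assms by (simp add: field_simps)
    moreover have "3 + slope b y = 3 * s" by (simp add: slope_def s_def)
    ultimately show ?thesis using s assms by (simp add: field_simps power2_eq_square)
  qed
  ultimately show ?thesis by simp
qed

lemma envelope_pos: "0 < envelope b j y"
  by (simp add: envelope_def)

lemma envelope_le_1: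
  assumes "0 < b" "0 < y" "j \<le> b + y"
  shows "envelope b j y \<le> 1"
proof -
  have "0 \<le> (b + y - j) * slope b y + (b + y - j)\<^sup>2 * (slope b y)\<^sup>2 / (6 * b)"
    using assms slope_pos[of b y] by (intro add_nonneg_nonneg mult_nonneg_nonneg) auto
  then show ?thesis by (simp add: envelope_def)
qed

lemma envelope_boundary: "envelope b (b + y) y = 1"
  by (simp add: envelope_def)

lemma envelope_start:
  assumes "0 < b" "0 < y"
  shows "envelope b y y = exp (- 2 * b\<^sup>2 / y)"
proof -
  have "b * slope b y + b\<^sup>2 * (slope b y)\<^sup>2 / (6 * b) = b * (slope b y * (6 + slope b y) * y) / (6 * y)"
    using assms by (simp add: field_simps power2_eq_square)
  also have "\<dots> = 2 * b\<^sup>2 / y"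
    unfolding slope_eq[OF assms] by (simp add: power2_eq_square)
  finally show ?thesis by (simp add: envelope_def)
qed

text \<open>Lowering \<open>j\<close> by one raises the distance \<open>d\<close> to the barrier by
  one, so all terms are multiples of \<open>envelope b j y\<close>. Eliminating \<open>y\<close> by
  \<open>slope_eq\<close> and cancelling this factor leaves
  \<open>supersolution_inequality\<close>.\<close>

lemma envelope_supersolution:
  assumes b: "0 < b" and y: "0 < y" and j: "0 \<le> j" "j \<le> b + y"
  obtains D where "(envelope b j has_real_derivative D) (at y)"
    and "j * envelope b (j - 1) y \<le> y * D + j * envelope b j y"
proof -
  define a where "a = slope b y"
  define d where "d = b + y - j"
  define e where "e = d / b"
  \<comment> \<open>\<open>w\<close> is the derivative in \<open>d\<close> of the exponent
    \<open>d * a + d\<^sup>2 * a\<^sup>2 / (6 * b)\<close>, and \<open>- q / y\<close> will be the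
    derivative of the slope in \<open>y\<close>.\<close>
  define w where "w = a + e * a\<^sup>2 / 3"
  define q where "q = a * (6 + a) / (2 * (3 + a))"
  have a: "0 < a" using slope_pos[OF b y] by (simp add: a_def)
  have y_eq: "y = 12 * b / (a * (6 + a))"
  proof -
    have "a * (6 + a) \<noteq> 0" using a by simp
    moreover have "y * (a * (6 + a)) = 12 * b"
      using slope_eq[OF b y] by (simp add: a_def mult.commute)
    ultimately show ?thesis by (rule nonzero_eq_divide_eq[THEN iffD2])
  qed
  have d: "0 \<le> d" using j by (simp add: d_def)
  have d_eq: "d = e * b" using b by (simp add: e_def)
  have e: "0 \<le> e" using d b by (simp add: e_def)
  have w: "w = a + d * a\<^sup>2 / (3 * b)" using b by (simp add: w_def e_def)
  define D where "D = - ((1 * a + d * (- q / y)) + (2 * d * a\<^sup>2 + d\<^sup>2 * (2 * a * (- q / y))) / (6 * b)) * envelope b j y"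
  have deriv_a: "(slope b has_real_derivative - q / y) (at y)"
    using slope_has_derivative[OF b y] by (simp add: q_def a_def)
  have deriv: "(envelope b j has_real_derivative D) (at y)"
  proof -
    have lin: "((\<lambda>y. b + y - j) has_real_derivative 1) (at y)"
      by (auto intro!: derivative_eq_intros)
    have lin2: "((\<lambda>y. (b + y - j)\<^sup>2) has_real_derivative 2 * d) (at y)"
      unfolding d_def by (auto intro!: derivative_eq_intros)
    have sq: "((\<lambda>y. (slope b y)\<^sup>2) has_real_derivative 2 * a * (- q / y)) (at y)"
      using DERIV_power[OF deriv_a, of 2] by (simp add: a_def mult_ac)
    show ?thesis
      unfolding envelope_def[abs_def] D_def d_def[symmetric] a_def[symmetric]
      using DERIV_chain2[OF DERIV_exp DERIV_minus[OF DERIV_add[OF DERIV_mult[OF lin deriv_a]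
            DERIV_cdivide[OF DERIV_mult[OF lin2 sq], of "6 * b"]]]]
      by (simp add: d_def[symmetric] a_def[symmetric] mult_ac add_ac)
  qed
  have yD: "y * D = w * (d * (6 + a) / (2 * (3 + a)) - y) * envelope b j y"
  proof -
    have "d * q * (1 + d * a / (3 * b)) = w * (d * (6 + a) / (2 * (3 + a)))"
      unfolding q_def w using a b by (simp add: power2_eq_square field_simps)
    moreover have "y * D = (d * q * (1 + d * a / (3 * b)) - w * y) * envelope b j y"
      unfolding D_def w using y b by (simp add: field_simps power2_eq_square)
    ultimately show ?thesis by (simp add: algebra_simps)
  qed
  have "envelope b (j - 1) y = envelope b j y * exp (- (a + (2 * d + 1) * a\<^sup>2 / (6 * b)))"
  proof -
    have "b + y - (j - 1) = d + 1" by (simp add: d_def)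
    moreover have "- ((d + 1) * a + (d + 1)\<^sup>2 * a\<^sup>2 / (6 * b)) =
        - (d * a + d\<^sup>2 * a\<^sup>2 / (6 * b)) + - (a + (2 * d + 1) * a\<^sup>2 / (6 * b))"
      using b by (simp add: field_simps power2_eq_square)
    ultimately show ?thesis
      unfolding envelope_def a_def[symmetric] d_def[symmetric] exp_add[symmetric] by (simp only:)
  qed
  also have "\<dots> \<le> envelope b j y * exp (- w)"
  proof -
    \<comment> \<open>The exponent is convex in \<open>d\<close>, so a unit step exceeds the
      derivative \<open>w\<close>; the excess \<open>a\<^sup>2 / (6 * b)\<close> is dropped.\<close>
    have "w \<le> a + (2 * d + 1) * a\<^sup>2 / (6 * b)"
      unfolding w using b by (simp add: field_simps)
    then show ?thesis by (simp add: envelope_pos)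
  qed
  finally have 1: "j * envelope b (j - 1) y \<le> j * (envelope b j y * exp (- w))"
    using j by (intro mult_left_mono) auto
  have jb: "j = b * (1 - e + 12 / (a * (6 + a)))"
  proof -
    have "j = b + y - d" by (simp add: d_def)
    also have "\<dots> = b + 12 * b / (a * (6 + a)) - e * b" using y_eq d_eq by metis
    finally show ?thesis by (simp add: algebra_simps)
  qed
  have "0 \<le> 1 - e + 12 / (a * (6 + a))"
    using j(1) b unfolding jb by (simp add: zero_le_mult_iff)
  from supersolution_inequality[OF a e this, folded w_def]
  have "0 \<le> b * (w * (e * (6 + a) / (2 * (3 + a)) - 12 / (a * (6 + a)))
           + (1 - e + 12 / (a * (6 + a))) * (1 - exp (- w)))"
    using b by (intro mult_nonneg_nonneg) auto
  also have "\<dots> = w * (e * b * (6 + a) / (2 * (3 + a)) - 12 * b / (a * (6 + a)))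
       + b * (1 - e + 12 / (a * (6 + a))) * (1 - exp (- w))"
    by (simp add: algebra_simps)
  also have "\<dots> = w * (d * (6 + a) / (2 * (3 + a)) - y) + j * (1 - exp (- w))"
    unfolding jb[symmetric] y_eq[symmetric] d_eq[symmetric] ..
  finally have "0 \<le> envelope b j y * (w * (d * (6 + a) / (2 * (3 + a)) - y) + j * (1 - exp (- w)))"
    using envelope_pos[of b j y] by (intro mult_nonneg_nonneg) auto
  also have "\<dots> = y * D + j * envelope b j y - j * (envelope b j y * exp (- w))"
    unfolding yD by (simp only: algebra_simps)
  finally have "j * envelope b (j - 1) y \<le> y * D + j * envelope b j y"
    using 1 by linarith
  with deriv show thesis by (rule that)
qed

section \<open>Crossing a linear barrier\<close>

lemma envelope_measurable [measurable]: "envelope b j \<in> borel_measurable borel"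
  unfolding envelope_def[abs_def] slope_def[abs_def] by measurable

text \<open>The integrand stands for the largest of \<open>n\<close> points lying at
  \<open>z\<close> and the other \<open>n - 1\<close> crossing below it. Multiplied by
  \<open>z ^ (n - 1)\<close>, the supersolution inequality bounds it by the derivative of
  \<open>G\<close>, so the integral is at most \<open>G y - G lo\<close>. Here
  \<open>G lo = lo ^ n\<close>, since either \<open>lo = 0\<close> or \<open>lo\<close> lies on the
  barrier, where the envelope is 1.\<close>

lemma nn_integral_envelope_le:
  fixes n :: nat and b y :: real
  defines "lo \<equiv> max 0 (real n - b)"
  assumes b: "0 < b" and y: "0 < y" "lo \<le> y" and n: "1 \<le> n"
  shows "(\<integral>\<^sup>+z. ennreal (real n * z ^ (n - 1) * envelope b (real n - 1) z) * indicator {lo<..y} z \<partial>lborel)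
    \<le> ennreal (y ^ n * envelope b (real n) y - lo ^ n)"
    and "lo ^ n \<le> y ^ n * envelope b (real n) y"
proof -
  define f where "f = (\<lambda>z. real n * z ^ (n - 1) * envelope b (real n - 1) z * indicator {lo<..y} z)"
  define G where "G = (\<lambda>z. z ^ n * envelope b (real n) z)"
  have lo: "0 \<le> lo" "real n - b \<le> lo" by (simp_all add: lo_def)
  have [measurable]: "f \<in> borel_measurable borel" unfolding f_def by measurable
  have f_nonneg: "0 \<le> f z" for z
    using lo by (auto simp: f_def envelope_pos less_imp_le split: split_indicator)
  have f_le: "f z \<le> real n * y ^ (n - 1)" for z
  proof (cases "z \<in> {lo<..y}")
    case True
    then have "z ^ (n - 1) * envelope b (real n - 1) z \<le> y ^ (n - 1) * 1"
      using lo b by (intro mult_mono power_mono envelope_le_1) (auto simp: envelope_pos less_imp_le)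
    then have "real n * (z ^ (n - 1) * envelope b (real n - 1) z) \<le> real n * y ^ (n - 1)"
      by (intro mult_left_mono) auto
    then show ?thesis using True by (simp add: f_def mult.assoc)
  qed (use y in \<open>simp add: f_def\<close>)
  have f_int: "integrable lborel f"
  proof (rule Bochner_Integration.integrable_bound)
    show "integrable lborel (\<lambda>z. real n * y ^ (n - 1) * indicator {lo..y} z :: real)"
      by (intro integrable_mult_right) (simp add: integrable_indicator_iff emeasure_lborel_Icc_eq)
    show "AE z in lborel. norm (f z) \<le> norm (real n * y ^ (n - 1) * indicator {lo..y} z :: real)"
      using f_nonneg f_le y by (auto simp: f_def split: split_indicator)
  qed simp
  have "\<exists>D. (G has_real_derivative D) (at z) \<and> f z \<le> D" if z: "0 < z" "lo \<le> z" for z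
  proof -
    have nz: "real n \<le> b + z" using z lo by auto
    obtain D where D: "(envelope b (real n) has_real_derivative D) (at z)"
      "real n * envelope b (real n - 1) z \<le> z * D + real n * envelope b (real n) z"
      using envelope_supersolution[OF b z(1), of "real n"] nz by auto
    have "(G has_real_derivative real n * z ^ (n - 1) * envelope b (real n) z + z ^ n * D) (at z)"
      unfolding G_def by (auto intro!: derivative_eq_intros D(1))
    moreover have "f z \<le> real n * z ^ (n - 1) * envelope b (real n) z + z ^ n * D"
    proof -
      have "f z \<le> z ^ (n - 1) * (real n * envelope b (real n - 1) z)"
        using z by (auto simp: f_def envelope_pos less_imp_le split: split_indicator)
      also have "\<dots> \<le> z ^ (n - 1) * (z * D + real n * envelope b (real n) z)"
        using D(2) z by (intro mult_left_mono) auto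
      also have "\<dots> = real n * z ^ (n - 1) * envelope b (real n) z + z ^ n * D"
        using n by (simp add: power_eq_if algebra_simps)
      finally show ?thesis .
    qed
    ultimately show ?thesis by blast
  qed
  then obtain G' where G': "\<And>z. 0 < z \<Longrightarrow> lo \<le> z \<Longrightarrow> (G has_real_derivative G' z) (at z)"
    "\<And>z. 0 < z \<Longrightarrow> lo \<le> z \<Longrightarrow> f z \<le> G' z"
    by metis
  have "continuous (at z within {lo..y}) G" if z: "z \<in> {lo..y}" for z
  proof (cases "0 < z")
    case True
    then show ?thesis
      using DERIV_isCont[OF G'(1)[OF True]] z by (auto intro: continuous_at_imp_continuous_at_within)
  next
    case False
    \<comment> \<open>The supersolution inequality needs \<open>0 < z\<close>. If
      \<open>lo = 0\<close>, however, then \<open>n \<le> b\<close>, so the envelope is at most 1 to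
      the right of 0 and \<open>z ^ n\<close> squeezes \<open>G\<close> to 0.\<close>
    then have z0: "z = 0" "lo = 0" using z lo by auto
    have "(G \<longlongrightarrow> 0) (at 0 within {0..y})"
    proof (rule Lim_null_comparison)
      show "((\<lambda>z. z ^ n) \<longlongrightarrow> 0) (at (0::real) within {0..y})"
        using n by (auto intro!: tendsto_eq_intros)
      have "norm (G x) \<le> x ^ n" if "0 \<le> x" for x
      proof (cases "x = 0")
        case True
        then show ?thesis using n by (cases n) (auto simp: G_def)
      next
        case False
        then have "x ^ n * envelope b (real n) x \<le> x ^ n * 1"
          using that lo z0 b by (intro mult_left_mono envelope_le_1) auto
        then show ?thesis using that by (simp add: G_def abs_mult envelope_pos less_imp_le)
      qed
      then show "\<forall>\<^sub>F x in at 0 within {0..y}. norm (G x) \<le> x ^ n"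
        by (auto simp: eventually_at_filter)
    qed
    moreover have "G 0 = 0" using n by (cases n) (auto simp: G_def)
    ultimately show ?thesis using z0 by (simp add: continuous_within)
  qed
  then have cont: "continuous_on {lo..y} G"
    by (simp add: continuous_on_eq_continuous_within)
  \<comment> \<open>The fundamental theorem needs the derivative only in the interior. At the
    endpoints \<open>H\<close> takes the value of \<open>f\<close>, so that it dominates
    \<open>f\<close> on the whole interval.\<close>
  define H where "H = (\<lambda>z. if z \<in> {lo<..<y} then G' z else f z)"
  have H: "(H has_integral (G y - G lo)) {lo..y}"
    using y(2) cont lo
    by (intro fundamental_theorem_of_calculus_interior)
      (auto simp: H_def has_real_derivative_iff_has_vector_derivative[symmetric] intro!: G'(1))
  have "((\<lambda>z. if z \<in> {lo..y} then f z else 0) has_integral (integral\<^sup>L lborel f)) UNIV"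
    using has_integral_integral_lborel[OF f_int]
    by (rule has_integral_eq[rotated]) (auto simp: f_def split: split_indicator)
  then have "(f has_integral (integral\<^sup>L lborel f)) {lo..y}"
    by (simp only: has_integral_restrict_UNIV)
  then have "integral\<^sup>L lborel f \<le> G y - G lo"
    using H by (rule has_integral_le) (use lo in \<open>auto simp: H_def intro!: G'(2)\<close>)
  also have "G lo = lo ^ n"
  proof (cases "lo = 0")
    case False
    then have "real n = b + lo" by (auto simp: lo_def max_def split: if_splits)
    then show ?thesis by (simp add: G_def envelope_boundary)
  qed (use n in \<open>cases n; simp add: G_def\<close>)
  finally have f_le_G: "integral\<^sup>L lborel f \<le> y ^ n * envelope b (real n) y - lo ^ n"
    by (simp add: G_def)
  moreover have "(\<integral>\<^sup>+z. ennreal (f z) \<partial>lborel) = ennreal (integral\<^sup>L lborel f)"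
    using f_int f_nonneg by (intro nn_integral_eq_integral) auto
  moreover have "(\<integral>\<^sup>+z. ennreal (f z) \<partial>lborel) =
      (\<integral>\<^sup>+z. ennreal (real n * z ^ (n - 1) * envelope b (real n - 1) z) * indicator {lo<..y} z \<partial>lborel)"
    by (intro nn_integral_cong) (auto simp: f_def split: split_indicator)
  ultimately show "(\<integral>\<^sup>+z. ennreal (real n * z ^ (n - 1) * envelope b (real n - 1) z) * indicator {lo<..y} z \<partial>lborel)
      \<le> ennreal (y ^ n * envelope b (real n) y - lo ^ n)"
    by (simp add: ennreal_leI)
  have "0 \<le> integral\<^sup>L lborel f" using f_nonneg by simp
  with f_le_G show "lo ^ n \<le> y ^ n * envelope b (real n) y" by linarith
qed

section \<open>The crossing event and its recursion on the largest point\<close>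

text \<open>It is enough to compare the number of points up to \<open>z\<close> with \<open>z + b\<close> when \<open>z\<close> is itself one of
  the points, since moving \<open>z\<close> down to the nearest point lowers only the barrier.\<close>

definition crossing :: "real \<Rightarrow> 'i set \<Rightarrow> real \<Rightarrow> ('i \<Rightarrow> real) set" where
  "crossing b J y = {u \<in> J \<rightarrow>\<^sub>E {0..y}. \<exists>i\<in>J. u i + b \<le> (\<Sum>k\<in>J. of_bool (u k \<le> u i))}"

text \<open>The right end \<open>g x\<close> may vary with \<open>x\<close> because in the recursion
  the largest coordinate becomes the new right end.\<close>

lemma pred_crossing [measurable]:
  assumes J [measurable]: "finite J" and [measurable]: "g \<in> borel_measurable M"
    and u: "\<And>k. k \<in> J \<Longrightarrow> (\<lambda>x. u x k) \<in> borel_measurable M"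
  shows "Measurable.pred M (\<lambda>x. restrict (u x) J \<in> crossing b J (g x))"
proof -
  have eq: "restrict (u x) J \<in> crossing b J (g x) \<longleftrightarrow>
     (\<forall>k\<in>J. 0 \<le> u x k \<and> u x k \<le> g x) \<and> (\<exists>i\<in>J. u x i + b \<le> (\<Sum>k\<in>J. of_bool (u x k \<le> u x i)))" for x
    by (auto simp: crossing_def PiE_iff cong: sum.cong)
  show ?thesis
    unfolding eq using u by measurable
qed

lemma crossing_measurable [measurable]:
  assumes J: "finite J"
  shows "crossing b J y \<in> sets (PiM J (\<lambda>_. lborel))"
proof -
  have "Measurable.pred (PiM J (\<lambda>_. lborel)) (\<lambda>u. restrict u J \<in> crossing b J y)"
    using J by (intro pred_crossing) auto
  then have "{u \<in> space (PiM J (\<lambda>_. lborel)). restrict u J \<in> crossing b J y} \<in> sets (PiM J (\<lambda>_. lborel))"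
    by (simp add: pred_def)
  also have "{u \<in> space (PiM J (\<lambda>_. lborel)). restrict u J \<in> crossing b J y} = crossing b J y"
    by (auto simp: crossing_def space_PiM PiE_iff extensional_restrict)
  finally show ?thesis .
qed

text \<open>If the largest point exceeds \<open>card J - b\<close>, the barrier is not crossed at that point, so the
  remaining points already cross it below.\<close>

lemma crossing_subset:
  fixes J :: "'i set"
  assumes J: "finite J" and b: "0 < b"
  defines "lo \<equiv> max 0 (real (card J) - b)"
  shows "crossing b J y \<subseteq> (J \<rightarrow>\<^sub>E {0..lo}) \<union>
    (\<Union>i\<in>J. {u \<in> J \<rightarrow>\<^sub>E UNIV. u i \<in> {lo<..y} \<and> restrict u (J - {i}) \<in> crossing b (J - {i}) (u i)})"
proof
  fix u assume u: "u \<in> crossing b J y"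
  then obtain m where m: "m \<in> J" "u m + b \<le> (\<Sum>k\<in>J. of_bool (u k \<le> u m))"
    and range: "\<And>k. k \<in> J \<Longrightarrow> 0 \<le> u k" "\<And>k. k \<in> J \<Longrightarrow> u k \<le> y" and ext: "u \<in> extensional J"
    by (auto simp: crossing_def PiE_iff)
  have "finite (u ` J)" "u ` J \<noteq> {}" using J m by auto
  then have "Max (u ` J) \<in> u ` J" by (rule Max_in)
  then obtain i where "i \<in> J" and Max: "Max (u ` J) = u i" by auto
  moreover have "u k \<le> u i" if "k \<in> J" for k
    using Max_ge[OF \<open>finite (u ` J)\<close>, of "u k"] that unfolding Max by simp
  ultimately have i: "i \<in> J" "\<And>k. k \<in> J \<Longrightarrow> u k \<le> u i" by auto
  show "u \<in> (J \<rightarrow>\<^sub>E {0..lo}) \<union>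
    (\<Union>i\<in>J. {u \<in> J \<rightarrow>\<^sub>E UNIV. u i \<in> {lo<..y} \<and> restrict u (J - {i}) \<in> crossing b (J - {i}) (u i)})"
  proof (cases "u i \<le> lo")
    case True
    then show ?thesis using i(2) range ext by (force simp: PiE_iff)
  next
    case False
    have "u m < u i"
    proof (rule ccontr)
      assume "\<not> u m < u i"
      then have "u i + b \<le> (\<Sum>k\<in>J. of_bool (u k \<le> u m))" using m by simp
      also have "\<dots> \<le> (\<Sum>k\<in>J. 1)" by (intro sum_mono) auto
      finally show False using False by (simp add: lo_def)
    qed
    then have "m \<noteq> i" by auto
    \<comment> \<open>The removed point lies strictly above the level \<open>u m\<close>, so it was
      not counted there.\<close>
    have "(\<Sum>k\<in>J. of_bool (u k \<le> u m)) = (\<Sum>k\<in>J - {i}. of_bool (u k \<le> u m) :: real)"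
      using J i(1) \<open>u m < u i\<close> by (subst sum.remove[of J i]) auto
    with m have "u m + b \<le> (\<Sum>k\<in>J - {i}. of_bool (u k \<le> u m))" by simp
    also have "\<dots> = (\<Sum>k\<in>J - {i}. of_bool (restrict u (J - {i}) k \<le> u m))"
      by (intro sum.cong) auto
    finally have "restrict u (J - {i}) m + b \<le>
        (\<Sum>k\<in>J - {i}. of_bool (restrict u (J - {i}) k \<le> restrict u (J - {i}) m))"
      using m(1) \<open>m \<noteq> i\<close> by simp
    moreover have "restrict u (J - {i}) \<in> J - {i} \<rightarrow>\<^sub>E {0..u i}"
      using i(2) range(1) by auto
    moreover have "m \<in> J - {i}" using m(1) \<open>m \<noteq> i\<close> by simp
    ultimately have "restrict u (J - {i}) \<in> crossing b (J - {i}) (u i)"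
      unfolding crossing_def by blast
    then show ?thesis using False i range ext by (auto simp: PiE_iff)
  qed
qed

text \<open>By Tonelli with coordinate \<open>i\<close> outermost: fixing it at \<open>z\<close>
  leaves the crossing event of the other points on \<open>[0, z]\<close>.\<close>

lemma emeasure_largest_fibre:
  assumes J: "finite J" "i \<in> J"
  shows "emeasure (PiM J (\<lambda>_. lborel))
      {u \<in> J \<rightarrow>\<^sub>E UNIV. u i \<in> {lo<..y} \<and> restrict u (J - {i}) \<in> crossing b (J - {i}) (u i)}
    = (\<integral>\<^sup>+z. emeasure (PiM (J - {i}) (\<lambda>_. lborel)) (crossing b (J - {i}) z) * indicator {lo<..y} z \<partial>lborel)"
    (is "emeasure _ ?B = _")
    and "{u \<in> J \<rightarrow>\<^sub>E UNIV. u i \<in> {lo<..y} \<and> restrict u (J - {i}) \<in> crossing b (J - {i}) (u i)}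
      \<in> sets (PiM J (\<lambda>_. lborel))"
proof -
  interpret product_sigma_finite "\<lambda>_::'a. lborel :: real measure" by unfold_locales
  let ?I = "J - {i}"
  have ins: "insert i ?I = J" using J by auto
  have [measurable]: "i \<in> J" by fact
  have [measurable]: "Measurable.pred (PiM J (\<lambda>_. lborel)) (\<lambda>u. restrict u (J - {i}) \<in> crossing b (J - {i}) (u i))"
    using J by (intro pred_crossing) auto
  have "{u \<in> space (PiM J (\<lambda>_. lborel)). u i \<in> {lo<..y} \<and> restrict u ?I \<in> crossing b ?I (u i)}
      \<in> sets (PiM J (\<lambda>_. lborel))"
    by measurable
  then show B [measurable]: "?B \<in> sets (PiM J (\<lambda>_. lborel))"
    by (simp add: space_PiM)
  have "emeasure (PiM J (\<lambda>_. lborel)) ?B = (\<integral>\<^sup>+u. indicator ?B u \<partial>PiM J (\<lambda>_. lborel))"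
    using B by simp
  also have "\<dots> = (\<integral>\<^sup>+z. (\<integral>\<^sup>+u. indicator ?B (u(i := z)) \<partial>PiM ?I (\<lambda>_. lborel)) \<partial>lborel)"
    using J by (intro product_nn_integral_insert_rev[of ?I i, unfolded ins]) (use B in measurable)
  also have "\<dots> = (\<integral>\<^sup>+z. (\<integral>\<^sup>+u. indicator (crossing b ?I z) u * indicator {lo<..y} z \<partial>PiM ?I (\<lambda>_. lborel)) \<partial>lborel)"
  proof (intro nn_integral_cong)
    fix z :: real and u assume "u \<in> space (PiM ?I (\<lambda>_. lborel :: real measure))"
    then have u: "u \<in> extensional ?I" by (simp add: space_PiM PiE_iff)
    have "restrict (u(i := z)) ?I = restrict u ?I" by (auto simp: restrict_def)
    then have "restrict (u(i := z)) ?I = u" using u by (simp add: extensional_restrict)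
    moreover have "u(i := z) \<in> J \<rightarrow>\<^sub>E UNIV"
      using u J by (auto simp: PiE_iff extensional_def)
    ultimately show "(indicator ?B (u(i := z)) :: ennreal) = indicator (crossing b ?I z) u * indicator {lo<..y} z"
      by (auto split: split_indicator)
  qed
  also have "\<dots> = (\<integral>\<^sup>+z. emeasure (PiM ?I (\<lambda>_. lborel)) (crossing b ?I z) * indicator {lo<..y} z \<partial>lborel)"
    using J by (intro nn_integral_cong) (simp add: nn_integral_multc)
  finally show "emeasure (PiM J (\<lambda>_. lborel)) ?B = \<dots>" .
qed

text \<open>Induction on the number of points. By \<open>crossing_subset\<close> the event is
  covered by a cube of side \<open>lo\<close> and, for each \<open>i\<close>, a set on which
  \<open>u i\<close> is the largest point. The induction hypothesis bounds every fibre of the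
  latter, and the sum over \<open>i\<close> is the integral in
  \<open>nn_integral_envelope_le\<close>. The term \<open>- lo ^ card J\<close> there cancels the
  volume of the cube.\<close>

lemma emeasure_crossing_le:
  assumes "finite J" "0 < b" "0 < y" "real (card J) \<le> b + y"
  shows "emeasure (PiM J (\<lambda>_. lborel)) (crossing b J y) \<le> ennreal (y ^ card J * envelope b (real (card J)) y)"
  using assms
proof (induction "card J" arbitrary: J y)
  case 0
  then have "crossing b J y = {}" by (auto simp: crossing_def)
  then show ?case by simp
next
  case (Suc n)
  let ?P = "\<lambda>J. PiM J (\<lambda>_. lborel :: real measure)"
  interpret product_sigma_finite "\<lambda>_::'a. lborel :: real measure" by unfold_locales
  define lo where "lo = max 0 (real (card J) - b)"
  have lo: "0 \<le> lo" "real (card J) - b \<le> lo" "lo \<le> y" using Suc.prems by (auto simp: lo_def)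
  define B where "B i = {u \<in> J \<rightarrow>\<^sub>E UNIV. u i \<in> {lo<..y} \<and> restrict u (J - {i}) \<in> crossing b (J - {i}) (u i)}" for i
  have B: "B i \<in> sets (?P J)" if "i \<in> J" for i
    unfolding B_def using emeasure_largest_fibre(2)[OF Suc.prems(1) that] .
  have cube: "(J \<rightarrow>\<^sub>E {0..lo}) \<in> sets (?P J)"
    using Suc.prems(1) by (intro sets_PiM_I_finite) auto
  have cardJ: "card J = Suc n" using Suc by simp
  have B_le: "emeasure (?P J) (B i) \<le>
      (\<integral>\<^sup>+z. ennreal (z ^ n * envelope b (real n) z) * indicator {lo<..y} z \<partial>lborel)" if i: "i \<in> J" for i
  proof -
    have n: "n = card (J - {i})" "finite (J - {i})" using i Suc.prems(1) cardJ by auto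
    \<comment> \<open>Above \<open>lo\<close> the pair \<open>(n, z)\<close> stays on the admissible
      side of the barrier: \<open>card J - b \<le> lo < z\<close> gives
      \<open>n \<le> b + z\<close>.\<close>
    have "emeasure (?P (J - {i})) (crossing b (J - {i}) z) \<le> ennreal (z ^ n * envelope b (real n) z)"
      if z: "lo < z" for z
      using Suc.hyps(1)[OF n(1) n(2) Suc.prems(2), of z] z lo n cardJ by auto
    then show ?thesis
      unfolding B_def emeasure_largest_fibre(1)[OF Suc.prems(1) i]
      by (intro nn_integral_mono) (auto split: split_indicator)
  qed
  have "emeasure (?P J) (\<Union>i\<in>J. B i) \<le> (\<Sum>i\<in>J. emeasure (?P J) (B i))"
    using B Suc.prems(1) by (intro emeasure_subadditive_finite) auto
  also have "(\<Sum>i\<in>J. emeasure (?P J) (B i)) \<le>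
      (\<Sum>i\<in>J. \<integral>\<^sup>+z. ennreal (z ^ n * envelope b (real n) z) * indicator {lo<..y} z \<partial>lborel)"
    by (intro sum_mono B_le)
  also have "\<dots> = ennreal (real (card J)) * (\<integral>\<^sup>+z. ennreal (z ^ n * envelope b (real n) z) * indicator {lo<..y} z \<partial>lborel)"
    by (simp add: ennreal_of_nat_eq_real_of_nat)
  also have "\<dots> = (\<integral>\<^sup>+z. ennreal (real (card J)) * (ennreal (z ^ n * envelope b (real n) z) * indicator {lo<..y} z) \<partial>lborel)"
    by (intro nn_integral_cmult[symmetric]) measurable
  also have "\<dots> = (\<integral>\<^sup>+z. ennreal (real (card J) * z ^ (card J - 1) * envelope b (real (card J) - 1) z) * indicator {lo<..y} z \<partial>lborel)"
  proof (intro nn_integral_cong)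
    fix z :: real
    have "real (card J) - 1 = real n" "card J - 1 = n" by (simp_all add: cardJ)
    then show "ennreal (real (card J)) * (ennreal (z ^ n * envelope b (real n) z) * indicator {lo<..y} z) =
        ennreal (real (card J) * z ^ (card J - 1) * envelope b (real (card J) - 1) z) * indicator {lo<..y} z"
      by (simp add: ennreal_mult'[symmetric] mult.assoc split: split_indicator)
  qed
  also have "\<dots> \<le> ennreal (y ^ card J * envelope b (real (card J)) y - lo ^ card J)"
    unfolding lo_def using Suc.prems lo cardJ by (intro nn_integral_envelope_le) (auto simp: lo_def)
  finally have UN: "emeasure (?P J) (\<Union>i\<in>J. B i)
      \<le> ennreal (y ^ card J * envelope b (real (card J)) y - lo ^ card J)" .
  have vol: "emeasure (?P J) (J \<rightarrow>\<^sub>E {0..lo}) = ennreal (lo ^ card J)"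
    using lo Suc.prems(1) by (subst emeasure_PiM) (auto simp: ennreal_power)
  have "emeasure (?P J) (crossing b J y) \<le> emeasure (?P J) ((J \<rightarrow>\<^sub>E {0..lo}) \<union> (\<Union>i\<in>J. B i))"
  proof (rule emeasure_mono)
    show "crossing b J y \<subseteq> (J \<rightarrow>\<^sub>E {0..lo}) \<union> (\<Union>i\<in>J. B i)"
      using crossing_subset[OF Suc.prems(1,2), of y] unfolding B_def lo_def .
    show "(J \<rightarrow>\<^sub>E {0..lo}) \<union> (\<Union>i\<in>J. B i) \<in> sets (?P J)"
      using B cube Suc.prems(1) by (intro sets.Un sets.finite_UN)
  qed
  also have "\<dots> \<le> emeasure (?P J) (J \<rightarrow>\<^sub>E {0..lo}) + emeasure (?P J) (\<Union>i\<in>J. B i)"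
    using cube B Suc.prems(1) by (intro emeasure_subadditive sets.finite_UN) auto
  also have "\<dots> \<le> ennreal (lo ^ card J) + ennreal (y ^ card J * envelope b (real (card J)) y - lo ^ card J)"
    unfolding vol by (intro add_left_mono UN)
  also have "\<dots> = ennreal (y ^ card J * envelope b (real (card J)) y)"
  proof -
    \<comment> \<open>\<open>ennreal\<close> truncates negative numbers to 0, so the cancellation
      needs this inequality.\<close>
    have "lo ^ card J \<le> y ^ card J * envelope b (real (card J)) y"
      unfolding lo_def using Suc.prems lo cardJ by (intro nn_integral_envelope_le) (auto simp: lo_def)
    then show ?thesis using lo by (simp flip: ennreal_plus)
  qed
  finally show ?case .
qed

section \<open>Gaussian vectors and the sphere\<close>

lemma PiM_density:
  fixes M :: "'i \<Rightarrow> 'a measure"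
  assumes I: "finite I"
    and M: "product_sigma_finite M" "product_sigma_finite (\<lambda>i. density (M i) (f i))"
    and f [measurable]: "\<And>i. f i \<in> borel_measurable (M i)"
  shows "PiM I (\<lambda>i. density (M i) (f i)) = density (PiM I M) (\<lambda>x. \<Prod>i\<in>I. f i (x i))"
proof -
  interpret M: product_sigma_finite M by fact
  interpret D: product_sigma_finite "\<lambda>i. density (M i) (f i)" by fact
  show ?thesis
  proof (rule D.PiM_eqI[symmetric, OF I])
    show "sets (density (PiM I M) (\<lambda>x. \<Prod>i\<in>I. f i (x i))) = sets (PiM I (\<lambda>i. density (M i) (f i)))"
      by (auto intro!: sets_PiM_cong)
    fix A assume A: "\<And>i. i \<in> I \<Longrightarrow> A i \<in> sets (density (M i) (f i))"
    then have A' [measurable]: "\<And>i. i \<in> I \<Longrightarrow> A i \<in> sets (M i)" by simp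
    have "emeasure (density (PiM I M) (\<lambda>x. \<Prod>i\<in>I. f i (x i))) (Pi\<^sub>E I A)
        = (\<integral>\<^sup>+x. (\<Prod>i\<in>I. f i (x i)) * indicator (Pi\<^sub>E I A) x \<partial>PiM I M)"
      using I A' by (intro emeasure_density) (auto intro!: sets_PiM_I_finite)
    also have "\<dots> = (\<integral>\<^sup>+x. (\<Prod>i\<in>I. f i (x i) * indicator (A i) (x i)) \<partial>PiM I M)"
    proof (intro nn_integral_cong)
      fix x assume "x \<in> space (PiM I M)"
      then have "x \<in> extensional I" by (simp add: space_PiM PiE_iff)
      then have "(indicator (Pi\<^sub>E I A) x :: ennreal) = (\<Prod>i\<in>I. indicator (A i) (x i))"
        using I by (auto simp: indicator_def PiE_iff prod_zero_iff)
      then show "(\<Prod>i\<in>I. f i (x i)) * indicator (Pi\<^sub>E I A) x = (\<Prod>i\<in>I. f i (x i) * indicator (A i) (x i))"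
        by (simp add: prod.distrib)
    qed
    also have "\<dots> = (\<Prod>i\<in>I. \<integral>\<^sup>+x. f i x * indicator (A i) x \<partial>M i)"
      using I by (intro M.product_nn_integral_prod) auto
    also have "\<dots> = (\<Prod>i\<in>I. emeasure (density (M i) (f i)) (A i))"
      using I by (intro prod.cong refl) (simp add: emeasure_density)
    finally show "emeasure (density (PiM I M) (\<lambda>x. \<Prod>i\<in>I. f i (x i))) (Pi\<^sub>E I A)
        = (\<Prod>i\<in>I. emeasure (density (M i) (f i)) (A i))" .
  qed
qed

lemma prod_Basis_vec:
  fixes f :: "real ^ 'n \<Rightarrow> 'b::comm_monoid_mult"
  shows "(\<Prod>b\<in>Basis. f b) = (\<Prod>i\<in>UNIV. f (axis i 1))"
proof -
  have Basis: "Basis = range (\<lambda>i::'n. axis i (1::real))" by (auto simp: Basis_vec_def)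
  have inj: "inj (\<lambda>i::'n. axis i (1::real))" by (simp add: inj_on_def axis_eq_axis)
  show ?thesis unfolding Basis by (simp add: prod.reindex[OF inj])
qed

lemma measurable_vec_lambda [measurable]:
  "(\<lambda>x. \<chi> i. x i) \<in> PiM UNIV (\<lambda>_::'n::finite. borel :: real measure) \<rightarrow>\<^sub>M (borel :: (real ^ 'n) measure)"
proof (subst borel_measurable_euclidean_space, rule ballI)
  fix b :: "real ^ 'n" assume "b \<in> Basis"
  then obtain i where "b = axis i 1" by (auto simp: Basis_vec_def)
  then show "(\<lambda>x. (\<chi> i. x i) \<bullet> b) \<in> borel_measurable (PiM UNIV (\<lambda>_. borel))"
    by (simp add: inner_axis)
qed

lemma distr_vec_lambda_lborel:
  "distr (PiM UNIV (\<lambda>_::'n::finite. lborel)) borel (\<lambda>x. \<chi> i. x i) = (lborel :: (real ^ 'n) measure)"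
proof (rule lborel_eqI[symmetric])
  interpret product_sigma_finite "\<lambda>_::'n. lborel :: real measure" by unfold_locales
  have [measurable]: "(\<lambda>x. \<chi> i. x i) \<in> PiM UNIV (\<lambda>_::'n. lborel) \<rightarrow>\<^sub>M (borel :: (real ^ 'n) measure)"
    using measurable_vec_lambda by (simp cong: measurable_cong_sets sets_PiM_cong)
  fix l u :: "real ^ 'n" assume le: "\<And>b. b \<in> Basis \<Longrightarrow> l \<bullet> b \<le> u \<bullet> b"
  have le': "l $ i \<le> u $ i" for i
    using le[of "axis i 1"] by (simp add: inner_axis axis_in_Basis_iff)
  have "(\<lambda>x. \<chi> i. x i) -` box l u \<inter> space (PiM UNIV (\<lambda>_::'n. lborel)) = (\<Pi>\<^sub>E i\<in>UNIV. {l $ i<..<u $ i})"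
    by (auto simp: mem_box_cart space_PiM PiE_iff)
  then have "emeasure (distr (PiM UNIV (\<lambda>_::'n. lborel)) borel (\<lambda>x. \<chi> i. x i)) (box l u)
      = (\<Prod>i\<in>UNIV. emeasure lborel {l $ i<..<u $ i})"
    by (simp add: emeasure_distr emeasure_PiM)
  also have "\<dots> = (\<Prod>i\<in>UNIV. ennreal (u $ i - l $ i))"
    using le' by simp
  also have "\<dots> = (\<Prod>b\<in>Basis. (u - l) \<bullet> b)"
    using le' by (simp add: prod_Basis_vec inner_axis prod_ennreal)
  finally show "emeasure (distr (PiM UNIV (\<lambda>_::'n. lborel)) borel (\<lambda>x. \<chi> i. x i)) (box l u)
      = (\<Prod>b\<in>Basis. (u - l) \<bullet> b)" .
qed simp

section \<open>The standard Gaussian law on vectors\<close>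

abbreviation std_normal_product :: "('n::finite \<Rightarrow> real) measure" where
  "std_normal_product \<equiv> PiM UNIV (\<lambda>_. std_normal_distribution)"

lemma prob_space_std_normal_product: "prob_space (std_normal_product :: ('n::finite \<Rightarrow> real) measure)"
  by (intro prob_space_PiM prob_space_normal_density) simp

lemma product_sigma_finite_std_normal: "product_sigma_finite (\<lambda>_::'n. std_normal_distribution)"
proof -
  interpret prob_space std_normal_distribution by (rule prob_space_normal_density) simp
  show ?thesis by unfold_locales
qed

text \<open>The product of the one-dimensional normal densities depends on the vector only through
  its Euclidean norm.\<close>

lemma nn_integral_std_normal_product_vec:
  fixes f :: "real ^ 'n \<Rightarrow> ennreal"
  assumes [measurable]: "f \<in> borel_measurable borel"
  shows "(\<integral>\<^sup>+x. f (\<chi> i. x i) \<partial>std_normal_product)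
    = ennreal ((1 / sqrt (2 * pi)) ^ CARD('n)) * (\<integral>\<^sup>+x. ennreal (exp (- (norm x)\<^sup>2 / 2)) * f x \<partial>lborel)"
proof -
  have [measurable]: "(\<lambda>x. \<chi> i. x i) \<in> PiM UNIV (\<lambda>_::'n. lborel) \<rightarrow>\<^sub>M (borel :: (real ^ 'n) measure)"
    using measurable_vec_lambda by (simp cong: measurable_cong_sets sets_PiM_cong)
  have psf: "product_sigma_finite (\<lambda>_::'n. lborel :: real measure)" by unfold_locales
  have "(\<integral>\<^sup>+x. f (\<chi> i. x i) \<partial>std_normal_product)
      = (\<integral>\<^sup>+x. (\<Prod>i\<in>UNIV. ennreal (std_normal_density (x i))) * f (\<chi> i. x i) \<partial>PiM UNIV (\<lambda>_. lborel))"
    by (subst PiM_density[OF finite psf product_sigma_finite_std_normal])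
      (auto intro!: nn_integral_density)
  also have "\<dots> = (\<integral>\<^sup>+x. ennreal ((1 / sqrt (2 * pi)) ^ CARD('n)) *
      (ennreal (exp (- (norm (\<chi> i. x i))\<^sup>2 / 2)) * f (\<chi> i. x i)) \<partial>PiM UNIV (\<lambda>_. lborel))"
  proof (intro nn_integral_cong)
    fix x :: "'n \<Rightarrow> real"
    have "(norm (\<chi> i. x i))\<^sup>2 = (\<Sum>i\<in>UNIV. (x i)\<^sup>2)"
      by (simp add: norm_vec_def L2_set_def sum_nonneg)
    then have "(\<Prod>i\<in>UNIV. std_normal_density (x i))
        = (1 / sqrt (2 * pi)) ^ CARD('n) * exp (- (norm (\<chi> i. x i))\<^sup>2 / 2)"
      by (simp add: std_normal_density_def prod_dividef exp_sum[symmetric] sum_negf sum_divide_distrib power_one_over)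
    then show "(\<Prod>i\<in>UNIV. ennreal (std_normal_density (x i))) * f (\<chi> i. x i)
       = ennreal ((1 / sqrt (2 * pi)) ^ CARD('n)) * (ennreal (exp (- (norm (\<chi> i. x i))\<^sup>2 / 2)) * f (\<chi> i. x i))"
      by (simp add: prod_ennreal normal_density_nonneg ennreal_mult' mult.assoc)
  qed
  also have "\<dots> = ennreal ((1 / sqrt (2 * pi)) ^ CARD('n)) *
      (\<integral>\<^sup>+x. ennreal (exp (- (norm (\<chi> i. x i))\<^sup>2 / 2)) * f (\<chi> i. x i) \<partial>PiM UNIV (\<lambda>_. lborel))"
    by (intro nn_integral_cmult) measurable
  also have "(\<integral>\<^sup>+x. ennreal (exp (- (norm (\<chi> i. x i))\<^sup>2 / 2)) * f (\<chi> i. x i) \<partial>PiM UNIV (\<lambda>_. lborel))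
      = (\<integral>\<^sup>+x. ennreal (exp (- (norm x)\<^sup>2 / 2)) * f x \<partial>lborel)"
    by (subst distr_vec_lambda_lborel[symmetric]) (auto simp: nn_integral_distr)
  finally show ?thesis .
qed

section \<open>Cones under Gaussian and Lebesgue measure\<close>

lemma nn_integral_gaussian_tail:
  assumes "0 \<le> r"
  shows "(\<integral>\<^sup>+\<rho>. ennreal (\<rho> * exp (- \<rho>\<^sup>2 / 2)) * indicator {r<..} \<rho> \<partial>lborel) = ennreal (exp (- r\<^sup>2 / 2))"
proof -
  have "(\<integral>\<^sup>+\<rho>. ennreal (\<rho> * exp (- \<rho>\<^sup>2 / 2)) * indicator {r<..} \<rho> \<partial>lborel)
      = (\<integral>\<^sup>+\<rho>. ennreal (\<rho> * exp (- \<rho>\<^sup>2 / 2)) * indicator {r..} \<rho> \<partial>lborel)"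
  proof (rule nn_integral_cong_AE)
    have "AE \<rho> in lborel. \<rho> \<noteq> r" by (rule AE_lborel_singleton)
    then show "AE \<rho> in lborel. ennreal (\<rho> * exp (- \<rho>\<^sup>2 / 2)) * indicator {r<..} \<rho>
        = ennreal (\<rho> * exp (- \<rho>\<^sup>2 / 2)) * indicator {r..} \<rho>"
      by eventually_elim (auto split: split_indicator)
  qed
  also have "\<dots> = ennreal (0 - (- exp (- r\<^sup>2 / 2)))"
  proof (rule nn_integral_FTC_atLeast)
    show "DERIV (\<lambda>x. - exp (- x\<^sup>2 / 2)) x :> x * exp (- x\<^sup>2 / 2)" for x :: real
      by (auto intro!: derivative_eq_intros)
    show "((\<lambda>x::real. - exp (- x\<^sup>2 / 2)) \<longlongrightarrow> 0) at_top"
      by real_asymp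
  qed (use assms in auto)
  finally show ?thesis by simp
qed

text \<open>Dilation by \<open>r\<close> maps a cone onto itself and the unit ball onto the ball of
  radius \<open>r\<close>, and it scales volume by \<open>r ^ DIM('a)\<close>.\<close>

lemma emeasure_lborel_cone_ball:
  fixes B :: "'a::euclidean_space set"
  assumes B: "B \<in> sets borel" and cone: "\<And>c x. 0 < c \<Longrightarrow> c *\<^sub>R x \<in> B \<longleftrightarrow> x \<in> B" and r: "0 < r"
  shows "emeasure lborel (B \<inter> ball 0 r) = ennreal (r ^ DIM('a)) * emeasure lborel (B \<inter> ball 0 1)"
proof -
  have [measurable]: "B \<in> sets borel" by fact
  have "(\<lambda>x. 0 + r *\<^sub>R x) -` (B \<inter> ball 0 r) = B \<inter> ball 0 1"
    using r cone[OF r] by (auto simp: mult_less_cancel_left_pos)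
  then have "emeasure (distr lborel borel (\<lambda>x. 0 + r *\<^sub>R x)) (B \<inter> ball 0 r) = emeasure lborel (B \<inter> ball 0 1)"
    by (subst emeasure_distr) auto
  moreover have "emeasure (lborel :: 'a measure) (B \<inter> ball 0 r) =
      emeasure (density (distr lborel borel (\<lambda>x. 0 + r *\<^sub>R x)) (\<lambda>_. \<bar>r\<bar> ^ DIM('a))) (B \<inter> ball 0 r)"
    using lborel_affine[of r "0 :: 'a"] r by simp
  ultimately show ?thesis
    using r by (simp add: emeasure_density_const)
qed

text \<open>By \<open>nn_integral_gaussian_tail\<close> the Gaussian density is a mixture of indicators of balls, so that a
  cone has Gaussian measure proportional to its volume inside the unit ball.\<close>

lemma nn_integral_gaussian_cone:
  fixes B :: "'a::euclidean_space set"
  assumes B: "B \<in> sets borel" and cone: "\<And>c x. 0 < c \<Longrightarrow> c *\<^sub>R x \<in> B \<longleftrightarrow> x \<in> B"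
  shows "(\<integral>\<^sup>+x. ennreal (exp (- (norm x)\<^sup>2 / 2)) * indicator B x \<partial>lborel)
    = (\<integral>\<^sup>+\<rho>. ennreal (\<rho> * exp (- \<rho>\<^sup>2 / 2) * \<rho> ^ DIM('a)) * indicator {0<..} \<rho> \<partial>lborel)
        * emeasure lborel (B \<inter> ball 0 1)"
proof -
  have [measurable]: "B \<in> sets borel" by fact
  let ?w = "\<lambda>\<rho>::real. ennreal (\<rho> * exp (- \<rho>\<^sup>2 / 2))"
  have [measurable]: "(\<lambda>(x, \<rho>). ?w \<rho> * indicator {norm x<..} \<rho> * indicator B x)
      \<in> borel_measurable (lborel \<Otimes>\<^sub>M lborel)"
  proof -
    have "(\<lambda>(x, \<rho>). ?w \<rho> * (if norm x < \<rho> then 1 else 0) * indicator B x)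
      \<in> borel_measurable (lborel \<Otimes>\<^sub>M lborel)" by measurable
    then show ?thesis by (simp add: indicator_def cong: if_cong)
  qed
  have "(\<integral>\<^sup>+x. ennreal (exp (- (norm x)\<^sup>2 / 2)) * indicator B x \<partial>lborel)
      = (\<integral>\<^sup>+x. (\<integral>\<^sup>+\<rho>. ?w \<rho> * indicator {norm x<..} \<rho> * indicator B x \<partial>lborel) \<partial>lborel)"
  proof (intro nn_integral_cong)
    fix x :: 'a
    have "(\<integral>\<^sup>+\<rho>. ?w \<rho> * indicator {norm x<..} \<rho> * indicator B x \<partial>lborel)
        = (\<integral>\<^sup>+\<rho>. ?w \<rho> * indicator {norm x<..} \<rho> \<partial>lborel) * indicator B x"
      by (rule nn_integral_multc) measurable
    then show "ennreal (exp (- (norm x)\<^sup>2 / 2)) * indicator B x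
        = (\<integral>\<^sup>+\<rho>. ?w \<rho> * indicator {norm x<..} \<rho> * indicator B x \<partial>lborel)"
      by (simp only: nn_integral_gaussian_tail[OF norm_ge_zero])
  qed
  also have "\<dots> = (\<integral>\<^sup>+\<rho>. (\<integral>\<^sup>+x. ?w \<rho> * indicator {norm x<..} \<rho> * indicator B x \<partial>lborel) \<partial>lborel)"
    by (intro lborel_pair.Fubini') measurable
  also have "\<dots> = (\<integral>\<^sup>+\<rho>. ennreal (\<rho> * exp (- \<rho>\<^sup>2 / 2) * \<rho> ^ DIM('a)) * indicator {0<..} \<rho>
        * emeasure lborel (B \<inter> ball 0 1) \<partial>lborel)"
  proof (intro nn_integral_cong)
    fix \<rho> :: real
    have "(\<integral>\<^sup>+x. ?w \<rho> * indicator {norm x<..} \<rho> * indicator B x \<partial>lborel)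
        = (\<integral>\<^sup>+x. ?w \<rho> * indicator (B \<inter> ball 0 \<rho>) x \<partial>lborel)"
      by (intro nn_integral_cong) (auto split: split_indicator)
    also have "\<dots> = ?w \<rho> * emeasure lborel (B \<inter> ball 0 \<rho>)"
      by (intro nn_integral_cmult_indicator) simp
    also have "\<dots> = ennreal (\<rho> * exp (- \<rho>\<^sup>2 / 2) * \<rho> ^ DIM('a)) * indicator {0<..} \<rho>
        * emeasure lborel (B \<inter> ball 0 1)"
    proof (cases "0 < \<rho>")
      case True
      then show ?thesis
        using emeasure_lborel_cone_ball[OF B cone True] by (simp add: ennreal_mult' mult.assoc)
    qed (simp add: ennreal_neg mult_nonpos_nonneg)
    finally show "(\<integral>\<^sup>+x. ?w \<rho> * indicator {norm x<..} \<rho> * indicator B x \<partial>lborel)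
        = ennreal (\<rho> * exp (- \<rho>\<^sup>2 / 2) * \<rho> ^ DIM('a)) * indicator {0<..} \<rho>
        * emeasure lborel (B \<inter> ball 0 1)" .
  qed
  also have "\<dots> = (\<integral>\<^sup>+\<rho>. ennreal (\<rho> * exp (- \<rho>\<^sup>2 / 2) * \<rho> ^ DIM('a)) * indicator {0<..} \<rho> \<partial>lborel)
        * emeasure lborel (B \<inter> ball 0 1)"
    by (intro nn_integral_multc) measurable
  finally show ?thesis .
qed

text \<open>The preimage of any set under normalization is a cone. Its Gaussian measure is a
  constant \<open>K\<close> times its volume in the unit ball, and \<open>uniform_sphere\<close>
  measures the same volume relative to the ball.\<close>

lemma distr_normalized_std_normal:
  "distr std_normal_product borel (\<lambda>x. (\<chi> i. x i) /\<^sub>R norm (\<chi> i. x i)) = (uniform_sphere :: (real ^ 'n) measure)"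
proof (rule measure_eqI)
  let ?p = "\<lambda>x::real ^ 'n. x /\<^sub>R norm x" and ?V = "\<lambda>B. emeasure lborel (B \<inter> ball (0 :: real ^ 'n) 1)"
  define K where "K = ennreal ((1 / sqrt (2 * pi)) ^ CARD('n)) *
    (\<integral>\<^sup>+\<rho>. ennreal (\<rho> * exp (- \<rho>\<^sup>2 / 2) * \<rho> ^ DIM(real ^ 'n)) * indicator {0<..} \<rho> \<partial>lborel)"
  have V [measurable]: "(\<lambda>x. \<chi> i. x i) \<in> std_normal_product \<rightarrow>\<^sub>M (borel :: (real ^ 'n) measure)"
    using measurable_vec_lambda by (simp cong: measurable_cong_sets sets_PiM_cong)
  have K: "emeasure std_normal_product ((\<lambda>x. \<chi> i. x i) -` B \<inter> space std_normal_product) = K * ?V B"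
    if B [measurable]: "B \<in> sets borel" and "\<And>c x. 0 < c \<Longrightarrow> c *\<^sub>R x \<in> B \<longleftrightarrow> x \<in> B" for B :: "(real ^ 'n) set"
  proof -
    have "emeasure std_normal_product ((\<lambda>x. \<chi> i. x i) -` B \<inter> space std_normal_product)
        = (\<integral>\<^sup>+x. indicator ((\<lambda>x. \<chi> i. x i) -` B \<inter> space std_normal_product) x \<partial>std_normal_product)"
      using measurable_sets[OF V B] by simp
    also have "\<dots> = (\<integral>\<^sup>+x. indicator B (\<chi> i. x i) \<partial>std_normal_product)"
      by (intro nn_integral_cong) (auto split: split_indicator)
    also have "\<dots> = K * ?V B"
    proof -
      have "(\<integral>\<^sup>+x. indicator B (\<chi> i. x i) \<partial>std_normal_product) = ennreal ((1 / sqrt (2 * pi)) ^ CARD('n)) *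
          (\<integral>\<^sup>+x. ennreal (exp (- (norm x)\<^sup>2 / 2)) * indicator B x \<partial>lborel)"
        by (rule nn_integral_std_normal_product_vec) measurable
      then show ?thesis
        by (simp only: nn_integral_gaussian_cone[OF that] K_def mult.assoc)
    qed
    finally show ?thesis .
  qed
  interpret P: prob_space "std_normal_product :: ('n \<Rightarrow> real) measure"
    by (rule prob_space_std_normal_product)
  \<comment> \<open>The radial integral in \<open>K\<close> need not be evaluated: the whole space
    is a cone of Gaussian measure 1.\<close>
  have "K * emeasure lborel (ball (0 :: real ^ 'n) 1) = 1"
    using K[of UNIV] P.emeasure_space_1 by simp
  then have K_eq: "K = 1 / emeasure lborel (ball (0 :: real ^ 'n) 1)"
    using emeasure_unit_ball[where 'a = "real ^ 'n"]
    by (metis ennreal_mult_divide_eq infinity_ennreal_def less_irrefl)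
  fix A assume "A \<in> sets (distr std_normal_product borel (\<lambda>x. ?p (\<chi> i. x i)))"
  then have A [measurable]: "A \<in> sets borel" by simp
  have pA [measurable]: "?p -` A \<in> sets borel"
    using measurable_sets[OF sphere_projection_measurable A] by simp
  have "emeasure (distr std_normal_product borel (\<lambda>x. ?p (\<chi> i. x i))) A
      = emeasure std_normal_product ((\<lambda>x. \<chi> i. x i) -` (?p -` A) \<inter> space std_normal_product)"
    by (subst emeasure_distr) (auto simp: vimage_def)
  also have "\<dots> = K * ?V (?p -` A)"
  proof (rule K)
    fix c :: real and x :: "real ^ 'n" assume "0 < c"
    then have "sgn (c *\<^sub>R x) = sgn x" by (simp add: sgn_scaleR)
    then show "c *\<^sub>R x \<in> ?p -` A \<longleftrightarrow> x \<in> ?p -` A"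
      by (simp only: vimage_eq sgn_div_norm)
  qed (rule pA)
  also have "\<dots> = ?V (?p -` A) / emeasure lborel (ball (0 :: real ^ 'n) 1)"
    by (simp add: K_eq divide_ennreal_def mult.commute)
  also have "\<dots> = emeasure uniform_sphere A"
    using pA by (simp add: uniform_sphere_def emeasure_distr Int_commute)
  finally show "emeasure (distr std_normal_product borel (\<lambda>x. ?p (\<chi> i. x i))) A = emeasure uniform_sphere A" .
qed (simp add: uniform_sphere_def)

section \<open>Chi-square tails\<close>

lemma ln_one_plus_ge_quadratic:
  fixes x :: real
  assumes "0 \<le> x"
  shows "x - x\<^sup>2 / 2 \<le> ln (1 + x)"
proof -
  define f where "f = (\<lambda>x::real. ln (1 + x) - x + x\<^sup>2 / 2)"
  have "f 0 \<le> f x"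
  proof (rule DERIV_nonneg_imp_nondecreasing[OF assms])
    fix y :: real assume y: "0 \<le> y"
    have "(f has_real_derivative y\<^sup>2 / (1 + y)) (at y)"
      unfolding f_def using y by (auto intro!: derivative_eq_intros simp: field_simps power2_eq_square)
    then show "\<exists>d. (f has_real_derivative d) (at y) \<and> 0 \<le> d" using y by fastforce
  qed
  then show ?thesis by (simp add: f_def)
qed

text \<open>The difference vanishes at 0 and its derivative is half a square.\<close>

lemma ln_one_plus_le_hyperbolic:
  fixes x :: real
  assumes "0 \<le> x"
  shows "ln (1 + x) \<le> (1 + x - 1 / (1 + x)) / 2"
proof -
  define f where "f = (\<lambda>x::real. (1 + x - 1 / (1 + x)) / 2 - ln (1 + x))"
  have "f 0 \<le> f x"
  proof (rule DERIV_nonneg_imp_nondecreasing[OF assms])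
    fix y :: real assume y: "0 \<le> y"
    have "(f has_real_derivative (1 + 1 / (1 + y)\<^sup>2) / 2 - 1 / (1 + y)) (at y)"
      unfolding f_def using y by (auto intro!: derivative_eq_intros simp: power2_eq_square)
    moreover have "(1 + 1 / (1 + y)\<^sup>2) / 2 - 1 / (1 + y) = (1 - 1 / (1 + y))\<^sup>2 / 2"
      by (simp add: power2_diff power_one_over field_simps)
    ultimately have "(f has_real_derivative (1 - 1 / (1 + y))\<^sup>2 / 2) (at y)" by simp
    then show "\<exists>d. (f has_real_derivative d) (at y) \<and> 0 \<le> d" by fastforce
  qed
  then show ?thesis by (simp add: f_def)
qed

text \<open>Exponential tilting by the square turns the standard normal density into
  \<open>\<sigma>\<close> times the centered normal density of variance
  \<open>1 / (1 - 2 * l)\<close>.\<close>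

lemma nn_integral_exp_square_std_normal:
  assumes l: "l < 1 / 2"
  shows "(\<integral>\<^sup>+x. ennreal (exp (l * x\<^sup>2)) \<partial>std_normal_distribution) = ennreal (1 / sqrt (1 - 2 * l))"
proof -
  define \<sigma> where "\<sigma> = 1 / sqrt (1 - 2 * l)"
  have \<sigma>: "0 < \<sigma>" "\<sigma>\<^sup>2 = 1 / (1 - 2 * l)" using l by (simp_all add: \<sigma>_def power_divide)
  have eq: "std_normal_density x * exp (l * x\<^sup>2) = \<sigma> * normal_density 0 \<sigma> x" for x
  proof -
    have "- x\<^sup>2 / 2 + l * x\<^sup>2 = - (x - 0)\<^sup>2 / (2 * \<sigma>\<^sup>2)"
      using l by (simp add: \<sigma>(2) field_simps)
    then have "exp (- x\<^sup>2 / 2) * exp (l * x\<^sup>2) = exp (- (x - 0)\<^sup>2 / (2 * \<sigma>\<^sup>2))"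
      by (simp only: exp_add[symmetric])
    moreover have "sqrt (2 * pi * \<sigma>\<^sup>2) = sqrt (2 * pi) * \<sigma>"
      using \<sigma>(1) by (simp add: real_sqrt_mult)
    ultimately show ?thesis
      unfolding std_normal_density_def mult.assoc normal_density_def using \<sigma>(1) by simp
  qed
  have "(\<integral>\<^sup>+x. ennreal (exp (l * x\<^sup>2)) \<partial>std_normal_distribution)
      = (\<integral>\<^sup>+x. ennreal (std_normal_density x) * ennreal (exp (l * x\<^sup>2)) \<partial>lborel)"
    by (intro nn_integral_density) auto
  also have "\<dots> = (\<integral>\<^sup>+x. ennreal \<sigma> * ennreal (normal_density 0 \<sigma> x) \<partial>lborel)"
    using \<sigma>(1) by (intro nn_integral_cong) (simp add: ennreal_mult[symmetric] normal_density_nonneg eq)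
  also have "\<dots> = ennreal \<sigma> * (\<integral>\<^sup>+x. ennreal (normal_density 0 \<sigma> x) \<partial>lborel)"
    by (intro nn_integral_cmult) auto
  also have "(\<integral>\<^sup>+x. ennreal (normal_density 0 \<sigma> x) \<partial>lborel) = 1"
    using \<sigma>(1) by (simp add: nn_integral_eq_integral normal_density_nonneg)
  finally show ?thesis by (simp add: \<sigma>_def)
qed

text \<open>Keeping \<open>l\<close> inside the event covers both tails: \<open>l > 0\<close> gives
  the upper one and \<open>l < 0\<close> the lower one.\<close>

lemma chi_square_chernoff:
  fixes l s :: real
  defines "P \<equiv> std_normal_product :: ('n::finite \<Rightarrow> real) measure"
  assumes l: "l < 1 / 2"
  shows "measure P {x \<in> space P. l * s \<le> l * (\<Sum>i\<in>UNIV. (x i)\<^sup>2)}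
    \<le> exp (- l * s - real CARD('n) * ln (1 - 2 * l) / 2)"
proof -
  interpret P: prob_space P unfolding P_def by (rule prob_space_std_normal_product)
  interpret psf: product_sigma_finite "\<lambda>_::'n. std_normal_distribution"
    by (rule product_sigma_finite_std_normal)
  have [measurable]: "(\<lambda>x. x i) \<in> borel_measurable P" for i
    unfolding P_def using measurable_component_singleton[of i UNIV "\<lambda>_. std_normal_distribution"]
    by (simp cong: measurable_cong_sets)
  define S where "S = (\<lambda>x::'n \<Rightarrow> real. \<Sum>i\<in>UNIV. (x i)\<^sup>2)"
  have [measurable]: "S \<in> borel_measurable P" unfolding S_def by measurable
  have "emeasure P {x \<in> space P. l * s \<le> l * S x}
      = emeasure P {x \<in> space P. 1 \<le> ennreal (exp (- l * s)) * ennreal (exp (l * S x))}"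
    by (intro arg_cong[where f = "emeasure P"]) (auto simp: ennreal_mult'[symmetric] exp_add[symmetric])
  also have "\<dots> \<le> ennreal (exp (- l * s)) * (\<integral>\<^sup>+x. ennreal (exp (l * S x)) * indicator (space P) x \<partial>P)"
    by (intro nn_integral_Markov_inequality) auto
  also have "(\<integral>\<^sup>+x. ennreal (exp (l * S x)) * indicator (space P) x \<partial>P)
      = (\<integral>\<^sup>+x. (\<Prod>i\<in>UNIV. ennreal (exp (l * (x i)\<^sup>2))) \<partial>P)"
    by (intro nn_integral_cong) (simp add: S_def prod_ennreal exp_sum sum_distrib_left)
  also have "\<dots> = (\<Prod>i\<in>(UNIV::'n set). \<integral>\<^sup>+x. ennreal (exp (l * x\<^sup>2)) \<partial>std_normal_distribution)"
    unfolding P_def by (intro psf.product_nn_integral_prod) auto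
  also have "\<dots> = ennreal ((1 / sqrt (1 - 2 * l)) ^ CARD('n))"
    using l by (simp add: nn_integral_exp_square_std_normal ennreal_power)
  also have "(1 / sqrt (1 - 2 * l)) ^ CARD('n) = exp (- real CARD('n) * ln (1 - 2 * l) / 2)"
  proof -
    have "1 / sqrt (1 - 2 * l) = exp (- (ln (1 - 2 * l) / 2))"
      using l by (simp add: exp_minus ln_sqrt[symmetric] inverse_eq_divide)
    then show ?thesis by (simp add: exp_of_nat_mult[symmetric])
  qed
  finally have "emeasure P {x \<in> space P. l * s \<le> l * S x}
      \<le> ennreal (exp (- l * s) * exp (- real CARD('n) * ln (1 - 2 * l) / 2))"
    by (simp add: ennreal_mult')
  then have "measure P {x \<in> space P. l * s \<le> l * S x}
      \<le> exp (- l * s) * exp (- real CARD('n) * ln (1 - 2 * l) / 2)"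
    by (simp add: P.emeasure_eq_measure)
  then show ?thesis by (simp add: S_def exp_add[symmetric])
qed

text \<open>The lower Laurent-Massart bound, from the Chernoff bound at \<open>l = - g\<close> and a
  quadratic bound for the logarithm.\<close>

lemma chi_square_lower_tail:
  fixes g :: real
  defines "P \<equiv> std_normal_product :: ('n::finite \<Rightarrow> real) measure"
  assumes g: "0 \<le> g"
  shows "measure P {x \<in> space P. (\<Sum>i\<in>UNIV. (x i)\<^sup>2) \<le> real CARD('n) * (1 - 2 * g)}
    \<le> exp (- real CARD('n) * g\<^sup>2)"
\<comment> \<open>At \<open>g = 0\<close> the right side is 1, and \<open>l = 0\<close> could not be
  cancelled from the Chernoff event.\<close>
proof (cases "g = 0")
  case True
  interpret P: prob_space P unfolding P_def by (rule prob_space_std_normal_product)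
  show ?thesis using True by simp
next
  case False
  with g have g: "0 < g" by simp
  let ?N = "real CARD('n)"
  have "measure P {x \<in> space P. - g * (?N * (1 - 2 * g)) \<le> - g * (\<Sum>i\<in>UNIV. (x i)\<^sup>2)}
      \<le> exp (- (- g) * (?N * (1 - 2 * g)) - ?N * ln (1 - 2 * (- g)) / 2)"
    unfolding P_def by (rule chi_square_chernoff) (use g in simp)
  also have "\<dots> \<le> exp (- ?N * g\<^sup>2)"
  proof -
    have "?N * (2 * g - (2 * g)\<^sup>2 / 2) \<le> ?N * ln (1 + 2 * g)"
      using g by (intro mult_left_mono ln_one_plus_ge_quadratic) auto
    then show ?thesis by (simp add: algebra_simps power2_eq_square)
  qed
  finally show ?thesis using g by simp
qed

text \<open>The upper Laurent-Massart bound; its threshold has the extra term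
  \<open>2 * g\<^sup>2\<close>.\<close>

lemma chi_square_upper_tail:
  fixes g :: real
  defines "P \<equiv> std_normal_product :: ('n::finite \<Rightarrow> real) measure"
  assumes g: "0 \<le> g"
  shows "measure P {x \<in> space P. real CARD('n) * (1 + 2 * g + 2 * g\<^sup>2) \<le> (\<Sum>i\<in>UNIV. (x i)\<^sup>2)}
    \<le> exp (- real CARD('n) * g\<^sup>2)"
proof (cases "g = 0")
  case True
  interpret P: prob_space P unfolding P_def by (rule prob_space_std_normal_product)
  show ?thesis using True by simp
next
  case False
  with g have g: "0 < g" by simp
  let ?N = "real CARD('n)"
  \<comment> \<open>This choice gives \<open>1 - 2 * l = 1 / (1 + 2 * g)\<close>, which reduces the
    exponent to \<open>ln_one_plus_le_hyperbolic\<close> at \<open>2 * g\<close>.\<close>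
  define l where "l = g / (1 + 2 * g)"
  have l: "0 < l" "l < 1 / 2" "1 - 2 * l = 1 / (1 + 2 * g)"
    using g by (simp_all add: l_def field_simps)
  have "measure P {x \<in> space P. l * (?N * (1 + 2 * g + 2 * g\<^sup>2)) \<le> l * (\<Sum>i\<in>UNIV. (x i)\<^sup>2)}
      \<le> exp (- l * (?N * (1 + 2 * g + 2 * g\<^sup>2)) - ?N * ln (1 - 2 * l) / 2)"
    unfolding P_def by (rule chi_square_chernoff) (use l in simp)
  also have "\<dots> \<le> exp (- ?N * g\<^sup>2)"
  proof -
    have "l * (1 + 2 * g + 2 * g\<^sup>2) - g\<^sup>2 = (1 + 2 * g - 1 / (1 + 2 * g)) / 4"
      using g by (simp add: l_def field_simps power2_eq_square)
    then have "ln (1 + 2 * g) / 2 \<le> l * (1 + 2 * g + 2 * g\<^sup>2) - g\<^sup>2"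
      using ln_one_plus_le_hyperbolic[of "2 * g"] g by simp
    then have "?N * (ln (1 + 2 * g) / 2) \<le> ?N * (l * (1 + 2 * g + 2 * g\<^sup>2) - g\<^sup>2)"
      by (rule mult_left_mono) simp
    moreover have "ln (1 - 2 * l) = - ln (1 + 2 * g)"
      unfolding l(3) using g by (simp add: ln_div)
    ultimately show ?thesis by (simp add: algebra_simps)
  qed
  finally show ?thesis using l by simp
qed

section \<open>The Dvoretzky-Kiefer-Wolfowitz-Massart inequality\<close>

text \<open>The joint density \<open>(1 / n) ^ card I\<close> cancels the power of
  \<open>y = n\<close> in the volume bound, leaving the starting value of the envelope.\<close>

lemma emeasure_PiM_uniform_crossing_le:
  fixes I :: "'i set"
  assumes I: "finite I" "I \<noteq> {}" and b: "0 < b"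
  defines "n \<equiv> real (card I)"
  shows "emeasure (PiM I (\<lambda>_. uniform_measure lborel {0..n})) (crossing b I n) \<le> ennreal (exp (- 2 * b\<^sup>2 / n))"
proof -
  have n: "0 < n" using I by (simp add: n_def card_gt_0_iff)
  let ?f = "\<lambda>x::real. indicator {0..n} x / emeasure lborel {0..n} :: ennreal"
  have psf: "product_sigma_finite (\<lambda>_::'i. lborel :: real measure)" by unfold_locales
  have "prob_space (uniform_measure lborel {0..n})"
    using n by (intro prob_space_uniform_measure) auto
  then interpret U: prob_space "density lborel ?f"
    by (simp add: uniform_measure_def)
  have psf': "product_sigma_finite (\<lambda>_::'i. density lborel ?f)" by unfold_locales
  have meas: "crossing b I n \<in> sets (PiM I (\<lambda>_. lborel))" using I by measurable
  have "emeasure (PiM I (\<lambda>_. uniform_measure lborel {0..n})) (crossing b I n)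
      = (\<integral>\<^sup>+x. (\<Prod>i\<in>I. ?f (x i)) * indicator (crossing b I n) x \<partial>PiM I (\<lambda>_. lborel))"
    unfolding uniform_measure_def using I meas
    by (subst PiM_density[OF I(1) psf psf']) (auto intro!: emeasure_density)
  also have "\<dots> = (\<integral>\<^sup>+x. ennreal ((1 / n) ^ card I) * indicator (crossing b I n) x \<partial>PiM I (\<lambda>_. lborel))"
  proof (intro nn_integral_cong)
    fix x
    have "(\<Prod>i\<in>I. ?f (x i)) = ennreal ((1 / n) ^ card I)" if "x \<in> crossing b I n"
    proof -
      have "(\<Prod>i\<in>I. ?f (x i)) = (\<Prod>i\<in>I. ennreal (1 / n))"
        using that n by (intro prod.cong) (auto simp: crossing_def PiE_iff divide_ennreal[symmetric])
      then show ?thesis using n by (simp add: ennreal_power)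
    qed
    then show "(\<Prod>i\<in>I. ?f (x i)) * indicator (crossing b I n) x
        = ennreal ((1 / n) ^ card I) * indicator (crossing b I n) x"
      by (auto split: split_indicator)
  qed
  also have "\<dots> = ennreal ((1 / n) ^ card I) * emeasure (PiM I (\<lambda>_. lborel)) (crossing b I n)"
    using meas by (rule nn_integral_cmult_indicator)
  also have "\<dots> \<le> ennreal ((1 / n) ^ card I) * ennreal (n ^ card I * envelope b (real (card I)) n)"
    using I b n by (intro mult_left_mono emeasure_crossing_le) (auto simp: n_def)
  also have "\<dots> = ennreal (envelope b n n)"
    using n by (simp add: ennreal_mult'[symmetric] n_def[symmetric] power_one_over)
  finally show ?thesis using b n by (simp add: envelope_start)
qed

section \<open>The probability integral transform\<close>

lemma measure_cdf_le:
  assumes D: "real_distribution D" and cont: "\<And>x. isCont (cdf D) x" and s: "0 \<le> s" "s < 1"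
  shows "measure D {x. cdf D x \<le> s} = s"
proof -
  interpret D: real_distribution D by fact
  have [measurable]: "cdf D \<in> borel_measurable D"
    using cont by (intro D.measurable_finite_borel borel_measurable_continuous_onI continuous_at_imp_continuous_on) auto
  have "{x \<in> space D. cdf D x \<le> s} \<in> sets D" by measurable
  then have meas: "{x. cdf D x \<le> s} \<in> sets D" by simp
  have attained: "\<exists>x. cdf D x = r" if r: "0 < r" "r < 1" for r
  proof -
    have "\<forall>\<^sub>F x in at_bot. cdf D x < r"
      using D.cdf_lim_at_bot r(1) by (rule order_tendstoD)
    then obtain a where a: "cdf D a < r"
      by (auto simp: eventually_at_bot_linorder)
    have "\<forall>\<^sub>F x in at_top. r < cdf D x"
      using D.cdf_lim_at_top_prob r(2) by (rule order_tendstoD)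
    then obtain b where b: "r < cdf D b"
      by (auto simp: eventually_at_top_linorder)
    have "a \<le> b" using D.cdf_nondecreasing[of b a] a b by linarith
    then show ?thesis using IVT[of "cdf D" a r b] a b cont by auto
  qed
  \<comment> \<open>The level \<open>s = 0\<close> need not be attained, so the upper bound goes
    through attained levels \<open>r\<close> just above \<open>s\<close>.\<close>
  have "measure D {x. cdf D x \<le> s} \<le> r" if r: "s < r" "r < 1" for r
  proof -
    obtain x where x: "cdf D x = r" using attained[of r] r s by auto
    have "y \<le> x" if "cdf D y \<le> s" for y
      using D.cdf_nondecreasing[of x y] that x r by linarith
    then have "measure D {x. cdf D x \<le> s} \<le> measure D {..x}"
      by (intro D.finite_measure_mono) auto
    then show ?thesis using x by (simp add: cdf_def)
  qed
  then have "measure D {x. cdf D x \<le> s} \<le> s"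
    using s(2) by (rule dense_ge_bounded[rotated])
  moreover have "s \<le> measure D {x. cdf D x \<le> s}"
  proof (cases "s = 0")
    case False
    then obtain x where x: "cdf D x = s" using attained[of s] s by auto
    have "measure D {..x} \<le> measure D {x. cdf D x \<le> s}"
      using meas by (intro D.finite_measure_mono) (auto simp: x[symmetric] D.cdf_nondecreasing)
    then show ?thesis using x by (simp add: cdf_def)
  qed simp
  ultimately show ?thesis by simp
qed

text \<open>The factor \<open>c\<close> serves to spread \<open>n\<close> sample points over
  \<open>[0, n]\<close>, where the expected count up to \<open>z\<close> is \<open>z\<close>
  itself.\<close>

lemma distr_scaled_cdf:
  assumes D: "real_distribution D" and cont: "\<And>x. isCont (cdf D) x" and c: "0 < c"
  shows "distr D borel (\<lambda>x. c * cdf D x) = uniform_measure lborel {0..c}"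
proof (rule cdf_unique)
  interpret D: real_distribution D by fact
  have meas [measurable]: "(\<lambda>x. c * cdf D x) \<in> borel_measurable D"
    using cont by (intro D.measurable_finite_borel borel_measurable_continuous_onI continuous_at_imp_continuous_on)
      (auto intro!: continuous_intros)
  show "real_distribution (distr D borel (\<lambda>x. c * cdf D x))"
    by (intro D.real_distribution_distr) simp
  show "real_distribution (uniform_measure lborel {0..c})"
    using c by (auto simp: real_distribution_def real_distribution_axioms_def intro!: prob_space_uniform_measure)
  show "cdf (distr D borel (\<lambda>x. c * cdf D x)) = cdf (uniform_measure lborel {0..c})"
  proof
    fix t
    have L: "cdf (distr D borel (\<lambda>x. c * cdf D x)) t = measure D {x. c * cdf D x \<le> t}"
      by (subst cdf_def2) (simp add: measure_distr vimage_def)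
    have R: "cdf (uniform_measure lborel {0..c}) t = measure lborel ({0..c} \<inter> {..t}) / c"
      using c by (simp add: cdf_def measure_uniform_measure)
    consider "t < 0" | "0 \<le> t" "t < c" | "c \<le> t" by linarith
    then show "cdf (distr D borel (\<lambda>x. c * cdf D x)) t = cdf (uniform_measure lborel {0..c}) t"
    proof cases
      case 1
      then have "{x. c * cdf D x \<le> t} = {}" "{0..c} \<inter> {..t} = {}"
        using c D.cdf_nonneg by (auto simp: not_le intro: less_le_trans mult_nonneg_nonneg)
      then show ?thesis unfolding L R by simp
    next
      case 2
      then have "{x. c * cdf D x \<le> t} = {x. cdf D x \<le> t / c}" "{0..c} \<inter> {..t} = {0..t}"
        using c by (auto simp: field_simps)
      moreover have "measure D {x. cdf D x \<le> t / c} = t / c"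
        using 2 c by (intro measure_cdf_le D cont) auto
      ultimately show ?thesis unfolding L R using 2 by simp
    next
      case 3
      have "c * cdf D x \<le> t" for x
        using mult_left_mono[OF D.cdf_bounded_prob[of x], of c] c 3 by linarith
      then have "{x. c * cdf D x \<le> t} = UNIV" "{0..c} \<inter> {..t} = {0..c}"
        using 3 by auto
      then show ?thesis unfolding L R using c D.prob_space by simp
    qed
  qed
qed

text \<open>Applying \<open>n * cdf D\<close> to each coordinate gives uniform points on
  \<open>[0, n]\<close>, for which an excess of \<open>e\<close> becomes a crossing at height
  \<open>n * e\<close>. A measurable cover \<open>C\<close> avoids proving measurability of an event
  quantified over all real \<open>z\<close>.\<close>

lemma DKW_upper:
  fixes I :: "'i set"
  assumes D: "real_distribution D" and cont: "\<And>x. isCont (cdf D) x"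
    and I: "finite I" "I \<noteq> {}" and e: "0 < e"
  obtains C where "C \<in> sets (PiM I (\<lambda>_. D))"
    and "emeasure (PiM I (\<lambda>_. D)) C \<le> ennreal (exp (- 2 * real (card I) * e\<^sup>2))"
    and "{x \<in> space (PiM I (\<lambda>_. D)).
      \<exists>z. cdf D z + e < 1 / real (card I) * (\<Sum>k\<in>I. of_bool (x k \<le> z))} \<subseteq> C"
proof -
  interpret D: real_distribution D by fact
  define n where "n = real (card I)"
  have n: "0 < n" using I by (simp add: n_def card_gt_0_iff)
  define T where "T = (\<lambda>x. n * cdf D x)"
  define U where "U = uniform_measure lborel {0..n}"
  have [measurable_cong]: "sets U = sets borel" by (simp add: U_def)
  have T_borel: "T \<in> borel_measurable borel"
    unfolding T_def using cont by (intro borel_measurable_continuous_onI continuous_at_imp_continuous_on)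
      (auto intro!: continuous_intros)
  then have T: "T \<in> D \<rightarrow>\<^sub>M U" by (simp cong: measurable_cong_sets add: U_def)
  have "prob_space U" unfolding U_def using n by (intro prob_space_uniform_measure) auto
  have "distr D U T = distr D borel T" by (rule distr_cong) (simp_all add: U_def)
  also have "\<dots> = U" unfolding T_def U_def using D cont n by (rule distr_scaled_cdf)
  finally have "distr (PiM I (\<lambda>_. D)) (PiM I (\<lambda>_. U)) (compose I T) = PiM I (\<lambda>_. U)"
    using distr_PiM_finite_prob_space[OF I(1), of "\<lambda>_. D" "\<lambda>_. U" T]
      D.prob_space_axioms \<open>prob_space U\<close> T
    by (simp add: product_prob_spaceI)
  have comp: "compose I T \<in> PiM I (\<lambda>_. D) \<rightarrow>\<^sub>M PiM I (\<lambda>_. U)"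
    unfolding compose_def using T by measurable
  have "crossing (n * e) I n \<in> sets (PiM I (\<lambda>_. lborel))" using I by measurable
  then have cr: "crossing (n * e) I n \<in> sets (PiM I (\<lambda>_. U))"
    by (simp add: U_def cong: sets_PiM_cong)
  define C where "C = compose I T -` crossing (n * e) I n \<inter> space (PiM I (\<lambda>_. D))"
  show thesis
  proof
    show "C \<in> sets (PiM I (\<lambda>_. D))" unfolding C_def using comp cr by (rule measurable_sets)
    have "emeasure (PiM I (\<lambda>_. D)) C = emeasure (PiM I (\<lambda>_. U)) (crossing (n * e) I n)"
      unfolding C_def emeasure_distr[OF comp cr, symmetric] by (simp only: \<open>distr (PiM I (\<lambda>_. D)) (PiM I (\<lambda>_. U)) (compose I T) = PiM I (\<lambda>_. U)\<close>)
    also have "\<dots> \<le> ennreal (exp (- 2 * (n * e)\<^sup>2 / n))"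
      unfolding U_def n_def using I e by (intro emeasure_PiM_uniform_crossing_le) (auto simp: card_gt_0_iff)
    also have "- 2 * (n * e)\<^sup>2 / n = - 2 * n * e\<^sup>2"
      using n by (simp add: power2_eq_square)
    finally show "emeasure (PiM I (\<lambda>_. D)) C \<le> ennreal (exp (- 2 * real (card I) * e\<^sup>2))"
      by (simp add: n_def)
    show "{x \<in> space (PiM I (\<lambda>_. D)).
      \<exists>z. cdf D z + e < 1 / real (card I) * (\<Sum>k\<in>I. of_bool (x k \<le> z))} \<subseteq> C"
    proof clarify
      fix x z assume x: "x \<in> space (PiM I (\<lambda>_. D))"
        and "cdf D z + e < 1 / real (card I) * (\<Sum>k\<in>I. of_bool (x k \<le> z))"
      then have exceed: "T z + n * e < (\<Sum>k\<in>I. of_bool (x k \<le> z))"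
        using n by (simp add: T_def n_def[symmetric] field_simps)
      \<comment> \<open>An excess at \<open>z\<close> forces some sample point below
        \<open>z\<close>; the largest such point \<open>x m\<close> takes the place of
        \<open>z\<close>.\<close>
      define S where "S = {k\<in>I. x k \<le> z}"
      have "S \<noteq> {}"
      proof
        assume "S = {}"
        then have "(\<Sum>k\<in>I. of_bool (x k \<le> z)) = (0::real)" by (auto simp: S_def intro!: sum.neutral)
        moreover have "0 \<le> T z" using n D.cdf_nonneg by (simp add: T_def)
        moreover have "0 < n * e" using n e by simp
        ultimately show False using exceed by linarith
    qed
    have "finite (x ` S)" "x ` S \<noteq> {}" using I \<open>S \<noteq> {}\<close> by (auto simp: S_def)
    then have "Max (x ` S) \<in> x ` S" by (rule Max_in)
    then obtain m where "m \<in> S" and Max: "Max (x ` S) = x m" by auto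
    have m: "m \<in> I" "x m \<le> z" using \<open>m \<in> S\<close> by (auto simp: S_def)
    have max: "x k \<le> x m" if "k \<in> I" "x k \<le> z" for k
      using Max_ge[OF \<open>finite (x ` S)\<close>, of "x k"] that unfolding Max by (simp add: S_def)
    have T_mono: "T u \<le> T v" if "u \<le> v" for u v
      using D.cdf_nondecreasing[OF that] n by (simp add: T_def)
    have "T (x m) + n * e \<le> (\<Sum>k\<in>I. of_bool (x k \<le> z))"
      using exceed T_mono[OF m(2)] by linarith
    \<comment> \<open>Only an inequality holds, because \<open>T\<close> may be flat and identify
      further points with \<open>x m\<close>.\<close>
    also have "\<dots> \<le> (\<Sum>k\<in>I. of_bool (compose I T x k \<le> compose I T x m))"
      using max m T_mono by (intro sum_mono) (auto simp: compose_def)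
    finally have "compose I T x m + n * e \<le> (\<Sum>k\<in>I. of_bool (compose I T x k \<le> compose I T x m))"
      using m(1) by (simp add: compose_def)
    moreover have "0 \<le> T u" "T u \<le> n" for u
      using mult_left_mono[OF D.cdf_bounded_prob[of u], of n] D.cdf_nonneg[of u] n by (auto simp: T_def)
    then have "compose I T x \<in> I \<rightarrow>\<^sub>E {0..n}" by (auto simp: compose_def)
    ultimately have "compose I T x \<in> crossing (n * e) I n"
      unfolding crossing_def using m(1) by blast
    then show "x \<in> C" using x by (simp add: C_def)
    qed
  qed
qed

text \<open>Reflection \<open>x \<mapsto> - x\<close> turns a deficit at \<open>z\<close> into an
  excess at \<open>- z\<close>, so \<open>DKW_upper\<close> applies to the reflected law.\<close>

lemma DKW_lower:
  fixes I :: "'i set"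
  assumes D: "real_distribution D" and cont: "\<And>x. isCont (cdf D) x"
    and I: "finite I" "I \<noteq> {}" and e: "0 < e"
  obtains C where "C \<in> sets (PiM I (\<lambda>_. D))"
    and "emeasure (PiM I (\<lambda>_. D)) C \<le> ennreal (exp (- 2 * real (card I) * e\<^sup>2))"
    and "{x \<in> space (PiM I (\<lambda>_. D)).
      \<exists>z. 1 / real (card I) * (\<Sum>k\<in>I. of_bool (x k \<le> z)) < cdf D z - e} \<subseteq> C"
proof -
  interpret D: real_distribution D by fact
  have atom: "measure D {x} = 0" for x
    using cont[of x] by (simp add: D.isCont_cdf)
  define R where "R = distr D borel uminus"
  have R: "real_distribution R"
    unfolding R_def by (intro D.real_distribution_distr) simp
  interpret R: real_distribution R by fact
  have cdf_R: "cdf R x = 1 - cdf D (- x)" for x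
  proof -
    have "cdf R x = measure D {- x..}"
      by (auto simp: cdf_def R_def measure_distr vimage_def intro!: arg_cong[where f = "measure D"])
    \<comment> \<open>Continuity makes the atom at \<open>- x\<close> null, so closed and open
      half-lines have equal mass.\<close>
    also have "{- x..} = {- x} \<union> {- x<..}" by auto
    also have "measure D \<dots> = measure D {- x<..}"
      by (subst D.finite_measure_Union) (auto simp: atom)
    also have "{- x<..} = space D - {..- x}" by auto
    also have "measure D \<dots> = 1 - cdf D (- x)"
      by (subst D.prob_compl) (auto simp: cdf_def)
    finally show ?thesis .
  qed
  have R_cont: "isCont (cdf R) x" for x
  proof -
    have "isCont (\<lambda>x. cdf D (- x)) x"
      by (rule isCont_o2[where g = "cdf D"]) (auto intro: cont)
    then have "isCont (\<lambda>x. 1 - cdf D (- x)) x" by (intro continuous_diff continuous_const)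
    moreover have "cdf R = (\<lambda>x. 1 - cdf D (- x))" by (rule ext) (rule cdf_R)
    ultimately show ?thesis by simp
  qed
  obtain C where C: "C \<in> sets (PiM I (\<lambda>_. R))"
    "emeasure (PiM I (\<lambda>_. R)) C \<le> ennreal (exp (- 2 * real (card I) * e\<^sup>2))"
    "{x \<in> space (PiM I (\<lambda>_. R)).
      \<exists>z. cdf R z + e < 1 / real (card I) * (\<Sum>k\<in>I. of_bool (x k \<le> z))} \<subseteq> C"
    by (rule DKW_upper[OF R R_cont I e])
  have um: "uminus \<in> D \<rightarrow>\<^sub>M R" by simp
  have "distr D R uminus = R"
    unfolding R_def by (rule distr_cong) simp_all
  then have eq: "distr (PiM I (\<lambda>_. D)) (PiM I (\<lambda>_. R)) (compose I uminus) = PiM I (\<lambda>_. R)"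
    using distr_PiM_finite_prob_space[OF I(1), of "\<lambda>_. D" "\<lambda>_. R" uminus]
      D.prob_space_axioms R.prob_space_axioms um
    by (simp add: product_prob_spaceI)
  have comp: "compose I uminus \<in> PiM I (\<lambda>_. D) \<rightarrow>\<^sub>M PiM I (\<lambda>_. R)"
    unfolding compose_def using um by measurable
  define C' where "C' = compose I uminus -` C \<inter> space (PiM I (\<lambda>_. D))"
  show thesis
  proof
    show "C' \<in> sets (PiM I (\<lambda>_. D))" unfolding C'_def using comp C(1) by (rule measurable_sets)
    show "emeasure (PiM I (\<lambda>_. D)) C' \<le> ennreal (exp (- 2 * real (card I) * e\<^sup>2))"
      using C(2) unfolding C'_def emeasure_distr[OF comp C(1), symmetric] eq .
    show "{x \<in> space (PiM I (\<lambda>_. D)).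
      \<exists>z. 1 / real (card I) * (\<Sum>k\<in>I. of_bool (x k \<le> z)) < cdf D z - e} \<subseteq> C'"
    proof clarify
      fix x z assume x: "x \<in> space (PiM I (\<lambda>_. D))"
        and less: "1 / real (card I) * (\<Sum>k\<in>I. of_bool (x k \<le> z)) < cdf D z - e"
      \<comment> \<open>Sample points equal to \<open>z\<close> are counted on both sides; this only
        increases the reflected excess.\<close>
      have "(\<Sum>k\<in>I. of_bool (x k \<le> z)) + (\<Sum>k\<in>I. of_bool (compose I uminus x k \<le> - z)) \<ge> (\<Sum>k\<in>I. 1 :: real)"
        unfolding sum.distrib[symmetric] by (intro sum_mono) (auto simp: compose_def)
      then have "1 \<le> 1 / real (card I) * ((\<Sum>k\<in>I. of_bool (x k \<le> z)) + (\<Sum>k\<in>I. of_bool (compose I uminus x k \<le> - z)))"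
        using I by (simp add: field_simps card_gt_0_iff)
      then have "cdf R (- z) + e < 1 / real (card I) * (\<Sum>k\<in>I. of_bool (compose I uminus x k \<le> - z))"
        using less by (simp add: cdf_R distrib_left)
      moreover have "compose I uminus x \<in> space (PiM I (\<lambda>_. R))"
        using comp x by (rule measurable_space)
      ultimately have "compose I uminus x \<in> C" using C(3) by blast
      then show "x \<in> C'" using x by (simp add: C'_def)
    qed
  qed
qed

section \<open>Empirical distribution on the sphere\<close>

lemma std_normal_atom: "measure std_normal_distribution {x} = 0"
proof -
  have "AE y in lborel. ennreal (std_normal_density y) * indicator {x} y = 0"
    using AE_lborel_singleton[of x] by eventually_elim auto
  then have "emeasure std_normal_distribution {x} = 0"
    by (subst emeasure_density) (auto simp: nn_integral_0_iff_AE)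
  then show ?thesis by (simp add: measure_def)
qed

lemma isCont_cdf_std_normal: "isCont (cdf std_normal_distribution) x"
proof -
  interpret real_distribution std_normal_distribution by (rule real_dist_normal_dist)
  show ?thesis by (simp add: isCont_cdf std_normal_atom)
qed

lemma std_normal_cdf_mono: "x \<le> y \<Longrightarrow> std_normal_cdf x \<le> std_normal_cdf y"
proof -
  interpret real_distribution std_normal_distribution by (rule real_dist_normal_dist)
  show "x \<le> y \<Longrightarrow> std_normal_cdf x \<le> std_normal_cdf y"
    by (simp add: std_normal_cdf_def cdf_nondecreasing)
qed

lemma std_normal_cdf_minus: "std_normal_cdf (- x) = 1 - std_normal_cdf x"
proof -
  interpret real_distribution std_normal_distribution by (rule real_dist_normal_dist)
  have "emeasure std_normal_distribution {..- x}
      = (\<integral>\<^sup>+y. ennreal (std_normal_density y) * indicator {..- x} y \<partial>distr lborel borel uminus)"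
    by (simp add: emeasure_density lborel_distr_uminus)
  also have "\<dots> = (\<integral>\<^sup>+y. ennreal (std_normal_density (- y)) * indicator {..- x} (- y) \<partial>lborel)"
    by (subst nn_integral_distr) auto
  also have "\<dots> = (\<integral>\<^sup>+y. ennreal (std_normal_density y) * indicator {x..} y \<partial>lborel)"
    by (intro nn_integral_cong) (auto simp: std_normal_density_def split: split_indicator)
  also have "\<dots> = emeasure std_normal_distribution {x..}"
    by (simp add: emeasure_density)
  finally have "measure std_normal_distribution {..- x} = measure std_normal_distribution {x..}"
    by (simp add: measure_def)
  also have "{x..} = {x} \<union> (space std_normal_distribution - {..x})" by auto
  also have "measure std_normal_distribution \<dots>
      = measure std_normal_distribution (space std_normal_distribution - {..x})"
    by (subst finite_measure_Union) (auto simp: std_normal_atom)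
  also have "\<dots> = 1 - measure std_normal_distribution {..x}"
    by (subst prob_compl) auto
  finally show ?thesis by (simp add: std_normal_cdf_def cdf_def)
qed

text \<open>\<open>gamma_dev\<close> is a one-sided supremum. For \<open>y > 0\<close> its value at
  \<open>y\<close> controls the increase caused by stretching, while its value at \<open>- y\<close>
  controls the decrease caused by shrinking, through the symmetry of the normal law.\<close>

lemma std_normal_cdf_scale_diff:
  assumes t: "0 \<le> t" "t < 1" and r: "1 / (1 + t) \<le> r" "r \<le> 1 / (1 - t)"
  shows "\<bar>std_normal_cdf (x * r) - std_normal_cdf x\<bar> \<le> gamma_dev t"
proof -
  have upper: "Phi_plus t y - std_normal_cdf y \<le> gamma_dev t" for y
    unfolding gamma_dev_def by (rule cSUP_upper[OF UNIV_I bdd_above_gamma_dev])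
  have pos: "\<bar>std_normal_cdf (y * r) - std_normal_cdf y\<bar> \<le> gamma_dev t" if y: "0 < y" for y
  proof -
    have "y * r \<le> y / (1 - t)"
      using mult_left_mono[OF r(2), of y] y by simp
    then have "std_normal_cdf (y * r) \<le> Phi_plus t y"
      using y by (simp add: Phi_plus_def std_normal_cdf_mono)
    moreover have "- (y * r) \<le> - y / (1 + t)"
      using mult_left_mono[OF r(1), of y] y by simp
    then have "std_normal_cdf (- (y * r)) \<le> Phi_plus t (- y)"
      using y by (simp add: Phi_plus_def std_normal_cdf_mono)
    ultimately show ?thesis
      using upper[of y] upper[of "- y"] by (simp add: std_normal_cdf_minus)
  qed
  consider "0 < x" | "x = 0" | "x < 0" by linarith
  then show ?thesis
  proof cases
    case 2
    then show ?thesis using upper[of 0] by (simp add: Phi_plus_def)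
  next
    case 3
    then show ?thesis
      using pos[of "- x"] by (simp add: std_normal_cdf_minus abs_minus_commute)
  qed (rule pos)
qed

lemma ecdf_scale:
  assumes "0 < r"
  shows "ecdf (z /\<^sub>R r) x = ecdf z (x * r)"
  using assms by (simp add: ecdf_def inverse_eq_divide pos_divide_le_eq)

lemma ks_dist_scale_le:
  fixes z :: "real ^ 'n"
  assumes t: "0 \<le> t" "t < 1" and r: "1 / (1 + t) \<le> r" "r \<le> 1 / (1 - t)"
    and z: "\<And>x. \<bar>ecdf z x - std_normal_cdf x\<bar> \<le> e"
  shows "ks_dist (ecdf (z /\<^sub>R r)) std_normal_cdf \<le> e + gamma_dev t"
  unfolding ks_dist_def
proof (rule cSUP_least)
  fix x
  have "0 < 1 / (1 + t)" using t by simp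
  then have "0 < r" using r by linarith
  then show "\<bar>ecdf (z /\<^sub>R r) x - std_normal_cdf x\<bar> \<le> e + gamma_dev t"
    using z[of "x * r"] std_normal_cdf_scale_diff[OF t r, of x] by (simp add: ecdf_scale)
qed simp

text \<open>\<open>g_plus\<close> is defined so that the threshold of the lower chi-square tail is
  the squared lower end of the range of \<open>r\<close>.\<close>

lemma g_plus_props:
  assumes "0 \<le> t"
  shows "0 \<le> g_plus t" "1 - 2 * g_plus t = (1 / (1 + t))\<^sup>2"
proof -
  show "0 \<le> g_plus t" using assms by (simp add: g_plus_def one_le_power)
  have "1 - 2 * g_plus t = 1 / (1 + t)\<^sup>2" unfolding g_plus_def by (simp add: diff_divide_distrib)
  then show "1 - 2 * g_plus t = (1 / (1 + t))\<^sup>2" by (simp only: power_one_over)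
qed

text \<open>\<open>g_minus\<close> is the nonnegative root of the quadratic that matches the upper
  chi-square threshold with the squared upper end of the range of \<open>r\<close>.\<close>

lemma g_minus_props:
  assumes t: "0 \<le> t" "t < 1"
  shows "0 \<le> g_minus t" "1 + 2 * g_minus t + 2 * (g_minus t)\<^sup>2 = (1 / (1 - t))\<^sup>2"
proof -
  define s where "s = sqrt (2 / (1 - t)\<^sup>2 - 1)"
  have "(1 - t)\<^sup>2 \<le> 1" using t by (intro power_le_one) auto
  then have "1 \<le> 1 / (1 - t)\<^sup>2" using t by simp
  then have *: "1 \<le> 2 / (1 - t)\<^sup>2 - 1" by simp
  then have s: "s\<^sup>2 = 2 / (1 - t)\<^sup>2 - 1" unfolding s_def by (intro real_sqrt_pow2) simp
  have "1 \<le> s" using * unfolding s_def by simp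
  moreover have g: "g_minus t = (s - 1) / 2" by (simp add: g_minus_def s_def)
  ultimately show "0 \<le> g_minus t" by simp
  have "1 + 2 * g_minus t + 2 * (g_minus t)\<^sup>2 = (1 + s\<^sup>2) / 2"
    unfolding g by (simp add: field_simps power2_eq_square)
  then show "1 + 2 * g_minus t + 2 * (g_minus t)\<^sup>2 = (1 / (1 - t))\<^sup>2"
    unfolding s by (simp add: power_one_over)
qed

theorem theorem2p1:
  fixes M :: "'w measure" and X :: "'w \<Rightarrow> real ^ 'n" and \<epsilon> t :: real
  assumes "prob_space M"
    and "X \<in> borel_measurable M"
    and "distr M borel X = uniform_sphere"
    and "\<epsilon> > 0"
    and "0 \<le> t" and "t < 1"
  shows "measure M {\<omega> \<in> space M.
            ks_dist (ecdf (sqrt (real CARD('n)) *\<^sub>R X \<omega>)) std_normal_cdf > \<epsilon> + gamma_dev t}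
         \<le> 2 * exp (- 2 * real CARD('n) * \<epsilon>\<^sup>2)
           + exp (- real CARD('n) * (g_plus t)\<^sup>2)
           + exp (- real CARD('n) * (g_minus t)\<^sup>2)"
proof -
  let ?N = "real CARD('n)"
  let ?P = "std_normal_product :: ('n \<Rightarrow> real) measure"
  interpret P: prob_space ?P by (rule prob_space_std_normal_product)
  define Z where "Z = (\<lambda>x::'n \<Rightarrow> real. \<chi> i. x i)"
  define B where "B = {v :: real ^ 'n. \<epsilon> + gamma_dev t < ks_dist (ecdf (sqrt ?N *\<^sub>R v)) std_normal_cdf}"
  have "{v \<in> space borel. \<epsilon> + gamma_dev t < ks_dist (ecdf (sqrt ?N *\<^sub>R v)) std_normal_cdf} \<in> sets borel"
    by measurable
  then have B: "B \<in> sets borel" by (simp add: B_def)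
  have Z_meas: "Z \<in> ?P \<rightarrow>\<^sub>M borel"
    unfolding Z_def using measurable_vec_lambda by (simp cong: measurable_cong_sets sets_PiM_cong)
  have U_meas: "(\<lambda>x. Z x /\<^sub>R norm (Z x)) \<in> ?P \<rightarrow>\<^sub>M borel"
    using measurable_compose[OF Z_meas sphere_projection_measurable] .
  define E where "E = {x \<in> space ?P. Z x /\<^sub>R norm (Z x) \<in> B}"
  \<comment> \<open>The probability depends only on the law of \<open>X\<close>, so it can be
    computed on the Gaussian product space.\<close>
  have "measure M {\<omega> \<in> space M. ks_dist (ecdf (sqrt ?N *\<^sub>R X \<omega>)) std_normal_cdf > \<epsilon> + gamma_dev t}
      = measure (distr M borel X) B"
    using assms(2) B by (subst measure_distr) (auto simp: B_def intro!: arg_cong[where f = "measure M"])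
  also have "\<dots> = measure (distr ?P borel (\<lambda>x. Z x /\<^sub>R norm (Z x))) B"
    unfolding assms(3) Z_def distr_normalized_std_normal ..
  also have "\<dots> = measure ?P E"
    using U_meas B by (subst measure_distr) (auto simp: E_def intro!: arg_cong[where f = "measure ?P"])
  also have "\<dots> \<le> 2 * exp (- 2 * ?N * \<epsilon>\<^sup>2) + exp (- ?N * (g_plus t)\<^sup>2) + exp (- ?N * (g_minus t)\<^sup>2)"
  proof -
    obtain C1 where C1: "C1 \<in> P.events" "emeasure ?P C1 \<le> ennreal (exp (- 2 * ?N * \<epsilon>\<^sup>2))"
      "{x \<in> space ?P. \<exists>z. cdf std_normal_distribution z + \<epsilon>
        < 1 / ?N * (\<Sum>k\<in>UNIV. of_bool (x k \<le> z))} \<subseteq> C1"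
      by (rule DKW_upper[OF real_dist_normal_dist isCont_cdf_std_normal finite UNIV_not_empty assms(4)])
    obtain C2 where C2: "C2 \<in> P.events" "emeasure ?P C2 \<le> ennreal (exp (- 2 * ?N * \<epsilon>\<^sup>2))"
      "{x \<in> space ?P. \<exists>z. 1 / ?N * (\<Sum>k\<in>UNIV. of_bool (x k \<le> z))
        < cdf std_normal_distribution z - \<epsilon>} \<subseteq> C2"
      by (rule DKW_lower[OF real_dist_normal_dist isCont_cdf_std_normal finite UNIV_not_empty assms(4)])
    \<comment> \<open>\<open>L\<close> and \<open>H\<close> are the events
      \<open>r \<le> 1 / (1 + t)\<close> and \<open>r \<ge> 1 / (1 - t)\<close> for the radius ratio
      \<open>r = norm (Z x) / sqrt ?N\<close>.\<close>
    define L where "L = {x \<in> space ?P. (\<Sum>i\<in>UNIV. (x i)\<^sup>2) \<le> ?N * (1 - 2 * g_plus t)}"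
    define H where "H = {x \<in> space ?P. ?N * (1 + 2 * g_minus t + 2 * (g_minus t)\<^sup>2) \<le> (\<Sum>i\<in>UNIV. (x i)\<^sup>2)}"
    have [measurable]: "(\<lambda>x. x i) \<in> borel_measurable ?P" for i
      using measurable_component_singleton[of i UNIV "\<lambda>_. std_normal_distribution"]
      by (simp cong: measurable_cong_sets)
    have LH: "L \<in> P.events" "H \<in> P.events" unfolding L_def H_def by measurable
    \<comment> \<open>Outside \<open>C1\<close> and \<open>C2\<close> the empirical CDF of
      \<open>Z x\<close> is uniformly within \<open>\<epsilon>\<close> of the normal one; outside
      \<open>L\<close> and \<open>H\<close> the rescaling by \<open>r\<close> costs at most
      \<open>gamma_dev t\<close>. A union bound over the four events then suffices.\<close>
    have "E \<subseteq> (C1 \<union> C2) \<union> (L \<union> H)"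
    proof
      fix x assume "x \<in> E"
      then have x: "x \<in> space ?P" "Z x /\<^sub>R norm (Z x) \<in> B" by (auto simp: E_def)
      show "x \<in> (C1 \<union> C2) \<union> (L \<union> H)"
      proof (rule ccontr)
        assume neg: "x \<notin> (C1 \<union> C2) \<union> (L \<union> H)"
        define r where "r = norm (Z x) / sqrt ?N"
        have N: "0 < ?N" by simp
        have r2: "r\<^sup>2 * ?N = (\<Sum>i\<in>UNIV. (x i)\<^sup>2)"
          by (simp add: r_def power_divide Z_def norm_vec_def L2_set_def sum_nonneg)
        have "?N * (1 / (1 + t))\<^sup>2 < r\<^sup>2 * ?N"
          using neg x by (simp add: L_def r2 g_plus_props[OF assms(5)] not_le)
        then have "(1 / (1 + t))\<^sup>2 < r\<^sup>2" using N by (simp add: mult.commute)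
        then have lower: "1 / (1 + t) \<le> r"
          by (rule less_imp_le[OF power2_less_imp_less]) (simp add: r_def)
        have "r\<^sup>2 * ?N < ?N * (1 / (1 - t))\<^sup>2"
          using neg x by (simp add: H_def r2 g_minus_props[OF assms(5,6)] not_le)
        then have "r\<^sup>2 < (1 / (1 - t))\<^sup>2" using N by (simp add: mult.commute)
        then have upper: "r \<le> 1 / (1 - t)"
          by (rule less_imp_le[OF power2_less_imp_less]) (use assms(6) in simp)
        have "\<bar>ecdf (Z x) z - std_normal_cdf z\<bar> \<le> \<epsilon>" for z
        proof -
          have "\<not> cdf std_normal_distribution z + \<epsilon> < 1 / ?N * (\<Sum>k\<in>UNIV. of_bool (x k \<le> z))"
            "\<not> 1 / ?N * (\<Sum>k\<in>UNIV. of_bool (x k \<le> z)) < cdf std_normal_distribution z - \<epsilon>"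
            using neg x(1) C1(3) C2(3) by blast+
          then show ?thesis
            unfolding ecdf_def std_normal_cdf_def Z_def by simp
        qed
        then have "ks_dist (ecdf (Z x /\<^sub>R r)) std_normal_cdf \<le> \<epsilon> + gamma_dev t"
          by (rule ks_dist_scale_le[OF assms(5,6) lower upper])
        moreover have "Z x /\<^sub>R r = sqrt ?N *\<^sub>R (Z x /\<^sub>R norm (Z x))"
          by (simp add: r_def divide_inverse mult.commute)
        ultimately show False using x(2) by (simp add: B_def)
      qed
    qed
    then have "measure ?P E \<le> measure ?P ((C1 \<union> C2) \<union> (L \<union> H))"
      using C1(1) C2(1) LH by (intro P.finite_measure_mono) auto
    also have "\<dots> \<le> measure ?P (C1 \<union> C2) + measure ?P (L \<union> H)"
      using C1(1) C2(1) LH by (intro measure_Un_le) auto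
    also have "\<dots> \<le> (measure ?P C1 + measure ?P C2) + (measure ?P L + measure ?P H)"
      using C1(1) C2(1) LH by (intro add_mono measure_Un_le) auto
    also have "\<dots> \<le> (exp (- 2 * ?N * \<epsilon>\<^sup>2) + exp (- 2 * ?N * \<epsilon>\<^sup>2)) +
        (exp (- ?N * (g_plus t)\<^sup>2) + exp (- ?N * (g_minus t)\<^sup>2))"
    proof (intro add_mono)
      show "measure ?P L \<le> exp (- ?N * (g_plus t)\<^sup>2)"
        unfolding L_def using g_plus_props[OF assms(5)] by (intro chi_square_lower_tail)
      show "measure ?P H \<le> exp (- ?N * (g_minus t)\<^sup>2)"
        unfolding H_def using g_minus_props[OF assms(5,6)] by (intro chi_square_upper_tail)
    qed (use C1(2) C2(2) in \<open>simp_all add: P.emeasure_eq_measure\<close>)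
    finally show ?thesis by simp
  qed
  finally show ?thesis .
qed

end
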